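(* Let $\varphi$ be an automorphism of $\mathbb{Z}^d$, and let $G=\mathbb{Z}\ltimes_\varphi \mathbb{Z}^d$. Denote by $P_\varphi(t)\in\mathbb{Z}[t]$ the characteristic polynomial of $\varphi$. Then the following hold: (1) For every prime $p$: $G$ is residually $p$ if and only if for every irreducible factor $P(t)\in\mathbb{Z}[t]$ of $P_\varphi(t)$ we have $P(1)\equiv 0 \bmod p$. (2) $G$ is residually $p$ for all primes $p$ if and only if $G$ is nilpotent, if and only if $\varphi$ is unipotent. (3) $G$ has a finite index subgroup which is residually $p$ for all primes $p$ if and only if $G$ is virtually nilpotent, if and only if $\varphi$ is quasi-unipotent.
   Context: For an automorphism $\varphi$ of $\mathbb{Z}^d$, the group $\mathbb{Z}\ltimes_\varphi\mathbb{Z}^d$ has underlying set $\mathbb{Z}\times\mathbb{Z}^d$ and operation $(i,x)\cdot(j,y)=(i+j,\,x+\varphi^i(y))$. A $p$-group is a finite group of order a power of the prime $p$. A group $G$ is residually $p$ if for every $g\in G$ with $g\ne 1$ there is a homomorphism $\alpha\colon G\to P$ to a $p$-group $P$ with $\alpha(g)\neq 1$. The automorphism $\varphi$ is unipotent if $(\varphi-\mathrm{id})^d=0$, and quasi-unipotent if $\varphi^k$ is unipotent for some $k>0$. A group is virtually nilpotent if it has a nilpotent subgroup of finite index. *)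

theory Defs
  imports
    "Jordan_Normal_Form.Char_Poly"
    "HOL-Algebra.Bij"
    "HOL-Algebra.Coset"
    "HOL-Algebra.Generated_Groups"
    "HOL-Number_Theory.Cong"
begin

definition p_group :: "nat \<Rightarrow> ('a, 'b) monoid_scheme \<Rightarrow> bool" where
  "p_group p P \<longleftrightarrow> group P \<and> finite (carrier P) \<and> (\<exists>n::nat. order P = p ^ n)"

text \<open>
  HOL cannot quantify over the type of the elements of the target \<open>P\<close>. A finite group is isomorphic
  to one with elements of type \<^typ>\<open>nat\<close>, so this type suffices; the lemma
  \<open>p_group_hom_nat\<close> below shows that no target is lost.
\<close>

definition residually_p :: "nat \<Rightarrow> ('a, 'b) monoid_scheme \<Rightarrow> bool" where
  "residually_p p G \<longleftrightarrow>
     (\<forall>g\<in>carrier G. g \<noteq> \<one>\<^bsub>G\<^esub> \<longrightarrow>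
        (\<exists>(P :: nat monoid) \<alpha>. p_group p P \<and> \<alpha> \<in> hom G P \<and> \<alpha> g \<noteq> \<one>\<^bsub>P\<^esub>))"

lemma p_group_hom_nat:
  fixes P :: "('c, 'd) monoid_scheme"
  assumes P: "p_group p P" and \<alpha>: "\<alpha> \<in> hom G P" and g: "g \<in> carrier G" "\<alpha> g \<noteq> \<one>\<^bsub>P\<^esub>"
  shows "\<exists>(Q :: nat monoid) \<beta>. p_group p Q \<and> \<beta> \<in> hom G Q \<and> \<beta> g \<noteq> \<one>\<^bsub>Q\<^esub>"
proof -
  interpret P: group P using P by (simp add: p_group_def)
  have fin: "finite (carrier P)" using P by (simp add: p_group_def)
  then obtain f :: "'c \<Rightarrow> nat" where f: "inj_on f (carrier P)"
    using finite_imp_inj_to_nat_seg by blast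
  define h where "h = inv_into (carrier P) f"
  have hf: "h (f x) = x" if "x \<in> carrier P" for x
    using f that by (simp add: h_def)
  define Q :: "nat monoid" where
    "Q = \<lparr>carrier = f ` carrier P, monoid.mult = (\<lambda>a b. f (h a \<otimes>\<^bsub>P\<^esub> h b)), one = f \<one>\<^bsub>P\<^esub>\<rparr>"
  have "group Q"
  proof (rule groupI)
    fix x assume "x \<in> carrier Q"
    then obtain u where u: "u \<in> carrier P" "x = f u" by (auto simp: Q_def)
    then show "\<exists>y\<in>carrier Q. y \<otimes>\<^bsub>Q\<^esub> x = \<one>\<^bsub>Q\<^esub>"
      by (intro bexI[of _ "f (inv\<^bsub>P\<^esub> u)"]) (auto simp: Q_def hf)
  qed (auto simp: Q_def hf P.m_assoc)
  moreover have "order Q = order P"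
    by (simp add: order_def Q_def card_image f)
  ultimately have "p_group p Q"
    using P fin by (simp add: p_group_def) (simp add: Q_def)
  moreover have "f \<circ> \<alpha> \<in> hom G Q"
    using \<alpha> by (auto simp: hom_def Q_def hf Pi_iff)
  moreover have "(f \<circ> \<alpha>) g \<noteq> \<one>\<^bsub>Q\<^esub>"
    using g \<alpha> f by (auto simp: hom_def Q_def Pi_iff inj_on_eq_iff)
  ultimately show ?thesis by blast
qed

primrec lower_central :: "('a, 'b) monoid_scheme \<Rightarrow> nat \<Rightarrow> 'a set" where
  "lower_central G 0 = carrier G"
| "lower_central G (Suc n) =
     generate G {x \<otimes>\<^bsub>G\<^esub> y \<otimes>\<^bsub>G\<^esub> inv\<^bsub>G\<^esub> x \<otimes>\<^bsub>G\<^esub> inv\<^bsub>G\<^esub> y | x y. x \<in> lower_central G n \<and> y \<in> carrier G}"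

definition nilpotent_group :: "('a, 'b) monoid_scheme \<Rightarrow> bool" where
  "nilpotent_group G \<longleftrightarrow> (\<exists>n. lower_central G n = {\<one>\<^bsub>G\<^esub>})"

definition finite_index_subgroup :: "'a set \<Rightarrow> ('a, 'b) monoid_scheme \<Rightarrow> bool" where
  "finite_index_subgroup H G \<longleftrightarrow> subgroup H G \<and> finite (rcosets\<^bsub>G\<^esub> H)"

definition virtually_nilpotent :: "('a, 'b) monoid_scheme \<Rightarrow> bool" where
  "virtually_nilpotent G \<longleftrightarrow>
     (\<exists>H. finite_index_subgroup H G \<and> nilpotent_group (G\<lparr>carrier := H\<rparr>))"

abbreviation Zpow :: "nat \<Rightarrow> int vec monoid" where
  "Zpow d \<equiv> monoid_vec TYPE(int) d"

text \<open>
  Integer powers of an automorphism are taken in \<^const>\<open>AutoGroup\<close>, whose multiplication is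
  composition.
\<close>

definition semidirect_Z :: "nat \<Rightarrow> (int vec \<Rightarrow> int vec) \<Rightarrow> (int \<times> int vec) monoid" where
  "semidirect_Z d \<phi> =
     \<lparr>carrier = UNIV \<times> carrier_vec d,
      monoid.mult = (\<lambda>(i, x) (j, y). (i + j, x + (\<phi> [^]\<^bsub>AutoGroup (Zpow d)\<^esub> i) y)),
      one = (0, 0\<^sub>v d)\<rparr>"

lemma group_semidirect_Z:
  assumes \<phi>: "\<phi> \<in> auto (Zpow d)"
  shows "group (semidirect_Z d \<phi>)"
proof -
  interpret Z: comm_group "Zpow d" by (rule comm_group_vec)
  interpret A: group "AutoGroup (Zpow d)" by (rule Z.AutoGroup)
  have car: "carrier (AutoGroup (Zpow d)) = auto (Zpow d)"
    by (simp add: AutoGroup_def)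
  define pw where "pw i = \<phi> [^]\<^bsub>AutoGroup (Zpow d)\<^esub> i" for i :: int
  have pw_auto: "pw i \<in> auto (Zpow d)" for i
    using A.int_pow_closed[of \<phi> i] \<phi> by (simp add: pw_def car)
  have pw_closed: "pw i x \<in> carrier_vec d" if "x \<in> carrier_vec d" for i x
    using pw_auto[of i] that by (auto simp: auto_def hom_def monoid_vec_def Pi_iff)
  have pw_add: "pw i (x + y) = pw i x + pw i y"
    if "x \<in> carrier_vec d" "y \<in> carrier_vec d" for i x y
    using pw_auto[of i] that by (auto simp: auto_def hom_def monoid_vec_def)
  have pw_pw: "pw (i + j) x = pw i (pw j x)" if "x \<in> carrier_vec d" for i j x
  proof -
    have "pw (i + j) = pw i \<otimes>\<^bsub>AutoGroup (Zpow d)\<^esub> pw j"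
      using A.int_pow_mult[of \<phi> i j] \<phi> by (simp add: pw_def car)
    moreover have "pw i \<in> Bij (carrier_vec d)" for i
      using pw_auto[of i] by (simp add: auto_def monoid_vec_def)
    ultimately show ?thesis
      using that by (simp add: AutoGroup_def BijGroup_def monoid_vec_def compose_def)
  qed
  have pw_0: "pw 0 x = x" if "x \<in> carrier_vec d" for x
    using that by (simp add: pw_def AutoGroup_def BijGroup_def monoid_vec_def)
  have G: "semidirect_Z d \<phi> =
     \<lparr>carrier = UNIV \<times> carrier_vec d,
      monoid.mult = (\<lambda>(i, x) (j, y). (i + j, x + pw i y)), one = (0, 0\<^sub>v d)\<rparr>"
    by (simp add: semidirect_Z_def pw_def)
  show ?thesis
  proof (rule groupI)
    fix x y z
    assume "x \<in> carrier (semidirect_Z d \<phi>)" "y \<in> carrier (semidirect_Z d \<phi>)"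
      "z \<in> carrier (semidirect_Z d \<phi>)"
    then show "x \<otimes>\<^bsub>semidirect_Z d \<phi>\<^esub> y \<otimes>\<^bsub>semidirect_Z d \<phi>\<^esub> z =
        x \<otimes>\<^bsub>semidirect_Z d \<phi>\<^esub> (y \<otimes>\<^bsub>semidirect_Z d \<phi>\<^esub> z)"
      by (auto simp: G pw_closed pw_add pw_pw assoc_add_vec[of _ d])
  next
    fix x assume "x \<in> carrier (semidirect_Z d \<phi>)"
    then obtain i v where x: "x = (i, v)" and v: "v \<in> carrier_vec d" by (auto simp: G)
    show "\<exists>y\<in>carrier (semidirect_Z d \<phi>). y \<otimes>\<^bsub>semidirect_Z d \<phi>\<^esub> x = \<one>\<^bsub>semidirect_Z d \<phi>\<^esub>"
      using pw_closed[OF v, of "- i"]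
      by (intro bexI[of _ "(- i, - pw (- i) v)"]) (auto simp: G x)
  qed (auto simp: G pw_closed pw_0)
qed

text \<open>The characteristic polynomial is that of the matrix of \<open>\<phi>\<close> in the standard basis.\<close>

definition matrix_of_auto :: "nat \<Rightarrow> (int vec \<Rightarrow> int vec) \<Rightarrow> int mat" where
  "matrix_of_auto d \<phi> = mat d d (\<lambda>(i, j). \<phi> (unit_vec d j) $ i)"

definition char_poly_auto :: "nat \<Rightarrow> (int vec \<Rightarrow> int vec) \<Rightarrow> int poly" where
  "char_poly_auto d \<phi> = char_poly (matrix_of_auto d \<phi>)"

definition unipotent :: "nat \<Rightarrow> (int vec \<Rightarrow> int vec) \<Rightarrow> bool" where
  "unipotent d \<phi> \<longleftrightarrow> (\<forall>x\<in>carrier_vec d. ((\<lambda>v. \<phi> v - v) ^^ d) x = 0\<^sub>v d)"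

definition quasi_unipotent :: "nat \<Rightarrow> (int vec \<Rightarrow> int vec) \<Rightarrow> bool" where
  "quasi_unipotent d \<phi> \<longleftrightarrow> (\<exists>k::nat. k > 0 \<and> unipotent d (\<phi> [^]\<^bsub>AutoGroup (Zpow d)\<^esub> k))"

end

theory Submission
  imports Defs
    "HOL-Computational_Algebra.Fundamental_Theorem_Algebra"
    "HOL-Algebra.Sylow"
    "HOL-Algebra.Multiplicative_Group"
begin

text \<open>
  Regard \<open>V\<close>, the lattice Z^d, as a module over Z[t] on which t acts as \<open>\<phi>\<close>, write s for t - 1, and let
  I be the ideal (s, p) of Z[t]: the polynomials f with f(1) divisible by p.

  \<^bold>\<open>Finite p-quotients see V modulo I^n.\<close> A homomorphism from G to a group of order p^M kills the
  image of t^(p^M) - 1 and of p^M in V. Modulo p the former is s^(p^M), so the homomorphism factors,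
  on V, through V / I^n V for some n. Conversely t^(p^M) - 1 lies in (s^n, p^n) for large M, so that
  \<open>\<phi>\<close> acts on V / (s^n V + p^n V) with order a power of p, and V modulo this sublattice extends to a
  finite p-quotient of G. As the Z-factor of G is residually p, the group G is residually p iff the
  intersection of the submodules s^n V + p^n V is trivial
  (\<open>residually_p_of_trivial_intersection\<close> and \<open>killed_vector_value_at_one\<close>).

  \<^bold>\<open>Krull's intersection theorem.\<close> That intersection is nonzero iff some nonzero v in V is killed by an
  f outside I. Indeed, if f v = 0 then some c = f(1)^N not divisible by p lies in (f, t^(p^M) - 1, p^M),
  so v dies in every finite p-quotient. The converse is \<open>krull_intersection\<close>; its proof replaces the
  Artin-Rees lemma by the ascending chain condition for subgroups of Z^d.

  \<^bold>\<open>Annihilators and the characteristic polynomial.\<close> The annihilator of a nonzero v is generated by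
  one nonunit polynomial, by Gauss's lemma, and it contains the characteristic polynomial, by the
  Cayley-Hamilton theorem. Hence f v = 0 forces a common irreducible factor P of f and of the
  characteristic polynomial, and P(1) divides f(1). Conversely every irreducible factor P of the
  characteristic polynomial kills some nonzero v, because det P(\<open>\<phi>\<close>) = 0. This proves the
  criterion for a single prime.

  \<^bold>\<open>All primes.\<close> An integer divisible by every prime is 0, so residual p-ness for all p means that
  all irreducible factors vanish at 1. Then the characteristic polynomial is s^d, and \<open>\<phi>\<close> is
  unipotent by Cayley-Hamilton. Commutators with V are governed by the powers of s: the (n+1)-st term
  of the lower central series of G lies in s^n V, and the n-th contains (1 - t)^n V. So G is nilpotent
  iff a power of s kills V.

  \<^bold>\<open>Finite index.\<close> Nilpotency and residual p-ness pass along injective homomorphisms. A subgroup of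
  finite index contains a copy of the semidirect product for \<open>\<phi>\<close>^m, for some m > 0, and the
  subgroup kZ x V is of finite index and isomorphic to the semidirect product for \<open>\<phi>\<close>^k. So the
  virtual statements reduce to the previous ones for powers of \<open>\<phi>\<close>.
\<close>


section \<open>Polynomials evaluated at a matrix\<close>

definition poly_mat :: "'a::comm_ring_1 mat \<Rightarrow> 'a poly \<Rightarrow> 'a mat" where
  "poly_mat A f =
     fold_coeffs (\<lambda>a B. a \<cdot>\<^sub>m 1\<^sub>m (dim_row A) + A * B) f (0\<^sub>m (dim_row A) (dim_row A))"

lemma poly_mat_0 [simp]: "A \<in> carrier_mat n n \<Longrightarrow> poly_mat A 0 = 0\<^sub>m n n"
  by (simp add: poly_mat_def)

lemma poly_mat_dim [simp]:
  "dim_row (poly_mat A f) = dim_row A" "dim_col (poly_mat A f) = dim_row A"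
proof -
  have "dim_row (poly_mat A f) = dim_row A \<and> dim_col (poly_mat A f) = dim_row A"
    by (induction f)
       (auto simp: poly_mat_def fold_coeffs_pCons_coeff_not_0_eq fold_coeffs_pCons_not_0_0_eq)
  then show "dim_row (poly_mat A f) = dim_row A" "dim_col (poly_mat A f) = dim_row A" by auto
qed

lemma poly_mat_pCons:
  assumes A: "A \<in> carrier_mat n n"
  shows "poly_mat A (pCons a f) = a \<cdot>\<^sub>m 1\<^sub>m n + A * poly_mat A f"
proof (cases "a = 0 \<and> f = 0")
  case True
  then show ?thesis using A by (auto simp: poly_mat_def)
next
  case False
  then show ?thesis using A
    by (cases "a = 0")
       (auto simp: poly_mat_def fold_coeffs_pCons_coeff_not_0_eq fold_coeffs_pCons_not_0_0_eq)
qed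

lemma poly_mat_carrier [simp]:
  "A \<in> carrier_mat n n \<Longrightarrow> poly_mat A f \<in> carrier_mat n n"
  by (intro carrier_matI) auto

lemma poly_mat_const [simp]: "A \<in> carrier_mat n n \<Longrightarrow> poly_mat A [:c:] = c \<cdot>\<^sub>m 1\<^sub>m n"
  by (simp add: poly_mat_pCons)

lemma poly_mat_1 [simp]: "A \<in> carrier_mat n n \<Longrightarrow> poly_mat A 1 = 1\<^sub>m n"
  unfolding one_pCons by (simp only: poly_mat_const) (auto intro: eq_matI)

lemma poly_mat_X: "A \<in> carrier_mat n n \<Longrightarrow> poly_mat A [:0, 1:] = A"
  by (subst poly_mat_pCons) (auto intro!: eq_matI)

lemma poly_mat_add:
  assumes A: "A \<in> carrier_mat n n"
  shows "poly_mat A (f + g) = poly_mat A f + poly_mat A g"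
proof (induction f g rule: poly_induct2)
  case 0
  then show ?case using A by simp
next
  case (pCons a f b g)
  have "A * poly_mat A (f + g) = A * poly_mat A f + A * poly_mat A g"
    unfolding pCons.IH
    by (rule mult_add_distrib_mat[OF A poly_mat_carrier[OF A] poly_mat_carrier[OF A]])
  then show ?case using A
    by (auto simp: poly_mat_pCons[OF A] algebra_simps intro!: eq_matI)
qed

lemma poly_mat_smult:
  assumes A: "A \<in> carrier_mat n n"
  shows "poly_mat A (Polynomial.smult c f) = c \<cdot>\<^sub>m poly_mat A f"
proof (induction f)
  case 0
  then show ?case using A by auto
next
  case (pCons a f)
  have "A * (c \<cdot>\<^sub>m poly_mat A f) = c \<cdot>\<^sub>m (A * poly_mat A f)"
    by (rule mult_smult_distrib[OF A poly_mat_carrier[OF A]])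
  then show ?case using A pCons.IH
    by (auto simp: poly_mat_pCons[OF A] algebra_simps intro!: eq_matI)
qed

lemma poly_mat_mult:
  assumes A: "A \<in> carrier_mat n n"
  shows "poly_mat A (f * g) = poly_mat A f * poly_mat A g"
proof (induction f)
  case 0
  then show ?case using A by simp
next
  case (pCons a f)
  have "poly_mat A (pCons a f * g) = a \<cdot>\<^sub>m poly_mat A g + A * poly_mat A (f * g)"
    using A by (auto simp: mult_pCons_left poly_mat_add[OF A] poly_mat_smult[OF A]
        poly_mat_pCons[OF A] intro!: eq_matI)
  also have "A * poly_mat A (f * g) = A * poly_mat A f * poly_mat A g"
    unfolding pCons.IH
    by (rule assoc_mult_mat[OF A poly_mat_carrier[OF A] poly_mat_carrier[OF A], symmetric])
  also have "a \<cdot>\<^sub>m poly_mat A g = (a \<cdot>\<^sub>m 1\<^sub>m n) * poly_mat A g"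
    using A by (subst mult_smult_assoc_mat[of _ n n _ n]) (auto simp: left_mult_one_mat[of _ n n])
  finally show ?case using A
    by (simp only: poly_mat_pCons[OF A], subst add_mult_distrib_mat[of _ n n _ _ n]) auto
qed

lemma poly_mat_sum_index:
  assumes A: "A \<in> carrier_mat n n" and ij: "i < n" "j < n"
  shows "poly_mat A (sum f S) $$ (i, j) = (\<Sum>k\<in>S. poly_mat A (f k) $$ (i, j))"
proof (induction S rule: infinite_finite_induct)
  case (insert x S)
  then show ?case using A ij by (simp add: poly_mat_add[OF A])
qed (use A ij in auto)

text \<open>
  Evaluating a polynomial matrix at \<open>A\<close> from the left sends the column m of tI - A to
  A e_m - A e_m = 0. This evaluation is linear over the polynomials, so it kills all columns of
  (tI - A) times its adjugate, and these are the multiples of the unit vectors by the characteristic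
  polynomial.
\<close>

theorem cayley_hamilton:
  fixes A :: "'a::comm_ring_1 mat"
  assumes A: "A \<in> carrier_mat n n"
  shows "poly_mat A (char_poly A) = 0\<^sub>m n n"
proof (rule eq_matI)
  let ?C = "char_poly_matrix A"
  let ?D = "adj_mat ?C"
  have C: "?C \<in> carrier_mat n n" using A by simp
  have D: "?D \<in> carrier_mat n n" by (rule adj_mat(1)[OF C])
  have CD: "?C * ?D = char_poly A \<cdot>\<^sub>m 1\<^sub>m n"
    using adj_mat(2)[OF C] by (simp add: char_poly_def)
  (* The left evaluation of column m of tI - A; D below multiplies from the right. *)
  have col0: "(\<Sum>j<n. poly_mat A (?C $$ (j, m)) $$ (l, j)) = 0" if "l < n" "m < n" for l m
  proof -
    have "poly_mat A (?C $$ (j, m)) $$ (l, j) =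
        (if j = m then A $$ (l, j) else 0) - (if j = l then A $$ (j, m) else 0)" if "j < n" for j
    proof -
      have "?C $$ (j, m) = (if j = m then [:0, 1:] else 0) + [:- A $$ (j, m):]"
        using A that \<open>m < n\<close> by (auto simp: char_poly_matrix_def)
      then show ?thesis
        using A that \<open>l < n\<close> by (auto simp: poly_mat_add[OF A] poly_mat_X[OF A])
    qed
    then show ?thesis using that by (simp add: sum_subtractf sum.delta)
  qed
  fix i k assume "i < dim_row (0\<^sub>m n n :: 'a mat)" "k < dim_col (0\<^sub>m n n :: 'a mat)"
  then have i: "i < n" and k: "k < n" by auto
  have "poly_mat A (char_poly A) $$ (i, k) =
      (\<Sum>j<n. poly_mat A ((?C * ?D) $$ (j, k)) $$ (i, j))"
  proof -
    have "(\<Sum>j<n. poly_mat A ((?C * ?D) $$ (j, k)) $$ (i, j)) =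
        (\<Sum>j<n. if j = k then poly_mat A (char_poly A) $$ (i, j) else 0)"
      unfolding CD using A i k by (intro sum.cong) auto
    then show ?thesis using k by simp
  qed
  also have "\<dots> = (\<Sum>j<n. \<Sum>m<n. \<Sum>l<n.
      poly_mat A (?D $$ (m, k)) $$ (i, l) * poly_mat A (?C $$ (j, m)) $$ (l, j))"
  proof (intro sum.cong refl)
    fix j assume "j \<in> {..<n}"
    then have j: "j < n" by simp
    have "(?C * ?D) $$ (j, k) = (\<Sum>m<n. ?D $$ (m, k) * ?C $$ (j, m))"
      using C D j k by (simp add: scalar_prod_def mult.commute lessThan_atLeast0)
    then show "poly_mat A ((?C * ?D) $$ (j, k)) $$ (i, j) = (\<Sum>m<n. \<Sum>l<n.
        poly_mat A (?D $$ (m, k)) $$ (i, l) * poly_mat A (?C $$ (j, m)) $$ (l, j))"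
      using A i j
      by (simp add: poly_mat_sum_index[OF A] poly_mat_mult[OF A] scalar_prod_def lessThan_atLeast0)
  qed
  also have "\<dots> = (\<Sum>m<n. \<Sum>l<n. poly_mat A (?D $$ (m, k)) $$ (i, l) *
      (\<Sum>j<n. poly_mat A (?C $$ (j, m)) $$ (l, j)))"
    unfolding sum_distrib_left
    by (subst sum.swap, rule sum.cong[OF refl], rule sum.swap)
  also have "\<dots> = 0" using col0 by simp
  finally show "poly_mat A (char_poly A) $$ (i, k) = 0\<^sub>m n n $$ (i, k)" using i k by simp
qed (use A in auto)

lemma poly_mat_eigenvector:
  fixes A :: "'a::field mat"
  assumes A: "A \<in> carrier_mat n n" and w: "w \<in> carrier_vec n" and ev: "A *\<^sub>v w = \<mu> \<cdot>\<^sub>v w"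
  shows "poly_mat A f *\<^sub>v w = poly f \<mu> \<cdot>\<^sub>v w"
proof (induction f)
  case 0
  then show ?case using A w by (auto intro!: eq_vecI)
next
  case (pCons a f)
  have "A * poly_mat A f *\<^sub>v w = A *\<^sub>v (poly f \<mu> \<cdot>\<^sub>v w)"
    using A w pCons.IH by (subst assoc_mult_mat_vec[of A n n _ n]) auto
  also have "\<dots> = poly f \<mu> \<cdot>\<^sub>v (\<mu> \<cdot>\<^sub>v w)"
    using A w by (subst mult_mat_vec[of A n n]) (auto simp: ev)
  finally have "A * poly_mat A f *\<^sub>v w = poly f \<mu> \<cdot>\<^sub>v (\<mu> \<cdot>\<^sub>v w)" .
  moreover have "a \<cdot>\<^sub>m 1\<^sub>m n *\<^sub>v w = a \<cdot>\<^sub>v w"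
    using w by (auto intro!: eq_vecI)
  moreover have "poly_mat A (pCons a f) *\<^sub>v w = a \<cdot>\<^sub>m 1\<^sub>m n *\<^sub>v w + A * poly_mat A f *\<^sub>v w"
    using A w by (simp only: poly_mat_pCons[OF A], subst add_mult_distrib_mat_vec[of _ n n]) auto
  ultimately show ?case using w
    by (auto simp: algebra_simps intro!: eq_vecI)
qed

lemma (in comm_ring_hom) poly_mat_hom:
  assumes A: "A \<in> carrier_mat n n"
  shows "map_mat hom (poly_mat A f) = poly_mat (map_mat hom A) (map_poly hom f)"
proof -
  have hA: "map_mat hom A \<in> carrier_mat n n" using A by simp
  show ?thesis
  proof (induction f)
    case 0
    then show ?case using A hA by (auto intro!: eq_matI)
  next
    case (pCons a f)
    have "map_mat hom (poly_mat A (pCons a f)) =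
        hom a \<cdot>\<^sub>m 1\<^sub>m n + map_mat hom A * map_mat hom (poly_mat A f)"
      unfolding poly_mat_pCons[OF A] using A
      by (subst mat_hom_mult[symmetric, of A n n _ n]) (auto simp: hom_add intro!: eq_matI)
    then show ?case
      by (simp add: pCons.IH map_poly_pCons_hom poly_mat_pCons[OF hA])
  qed
qed

text \<open>
  A complex root \<open>\<mu>\<close> of P is an eigenvalue of \<open>A\<close>, and an eigenvector for it lies in the kernel of
  P(A). So P(A) is singular over the complex numbers, hence already over the integers.
\<close>

lemma irreducible_factor_has_kernel:
  fixes A :: "int mat"
  assumes A: "A \<in> carrier_mat n n" and P: "degree P > 0" and dvd: "P dvd char_poly A"
  obtains v where "v \<in> carrier_vec n" "v \<noteq> 0\<^sub>v n" "poly_mat A P *\<^sub>v v = 0\<^sub>v n"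
proof -
  let ?h = "of_int :: int \<Rightarrow> complex"
  let ?A = "map_mat ?h A"
  have hA: "?A \<in> carrier_mat n n" using A by simp
  have "\<not> constant (poly (map_poly ?h P))"
    using P by (simp add: constant_degree)
  then obtain \<mu> where \<mu>: "poly (map_poly ?h P) \<mu> = 0"
    using fundamental_theorem_of_algebra by blast
  obtain Q where Q: "char_poly A = P * Q" using dvd by auto
  have "poly (char_poly ?A) \<mu> = 0"
    by (simp add: of_int_hom.char_poly_hom[OF A] Q hom_distribs \<mu>)
  then have "eigenvalue ?A \<mu>" using eigenvalue_root_char_poly[OF hA] by simp
  then obtain w where w: "w \<in> carrier_vec n" "w \<noteq> 0\<^sub>v n" "?A *\<^sub>v w = \<mu> \<cdot>\<^sub>v w"
    using hA by (auto simp: eigenvalue_def eigenvector_def)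
  have "poly_mat ?A (map_poly ?h P) *\<^sub>v w = 0\<^sub>v n"
    using poly_mat_eigenvector[OF hA w(1,3)] w \<mu> by auto
  then have "det (map_mat ?h (poly_mat A P)) = 0"
    using det_0_iff_vec_prod_zero[of "map_mat ?h (poly_mat A P)" n] w A
    by (auto simp: of_int_hom.poly_mat_hom[OF A])
  then have "det (poly_mat A P) = 0" by (simp add: of_int_hom.hom_det)
  then show ?thesis
    using det_0_iff_vec_prod_zero[of "poly_mat A P" n] A that by auto
qed

section \<open>The lattice as a module over the integer polynomials\<close>

lemma primitive_dvd_smult:
  fixes g h :: "int poly"
  assumes g: "content g = 1" and dvd: "g dvd Polynomial.smult c h" and c: "c \<noteq> 0"
  shows "g dvd h"
proof -
  obtain q where q: "Polynomial.smult c h = g * q" using dvd by auto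
  have "content (Polynomial.smult c h) = content g * content q"
    unfolding q by (rule content_mult)
  then have "\<bar>c\<bar> * content h = content q" using g by simp
  then have "c dvd content q" by (metis abs_dvd_iff dvd_triv_left)
  then obtain q' where "q = [:c:] * q'" by (auto simp: const_poly_dvd_iff_dvd_content[symmetric])
  then have "[:c:] * h = [:c:] * (g * q')" using q by (simp add: mult.left_commute)
  then have "h = g * q'" using c by (metis mult_left_cancel pCons_eq_0_iff)
  then show ?thesis by simp
qed

text \<open>
  The locale makes Z^d a module over Z[t], with t acting as the matrix. Identities between operators
  are then proved in the commutative ring Z[t], and multiplication by an integer c is the action of the
  constant polynomial c.
\<close>

locale int_matrix =
  fixes A :: "int mat" and d :: nat
  assumes A: "A \<in> carrier_mat d d"
begin

definition act :: "int poly \<Rightarrow> int vec \<Rightarrow> int vec" where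
  "act f v = poly_mat A f *\<^sub>v v"

lemma act_closed [simp]: "act f v \<in> carrier_vec d"
  by (rule carrier_vecI) (use A in \<open>auto simp: act_def\<close>)

lemma act_dim [simp]: "dim_vec (act f v) = d"
  using act_closed[of f v] by (rule carrier_vecD)

lemma act_add: "v \<in> carrier_vec d \<Longrightarrow> act (f + g) v = act f v + act g v"
  using A by (simp add: act_def poly_mat_add add_mult_distrib_mat_vec[of _ d d])

lemma act_mult: "v \<in> carrier_vec d \<Longrightarrow> act (f * g) v = act f (act g v)"
  unfolding act_def poly_mat_mult[OF A] using A by (intro assoc_mult_mat_vec) auto

lemma act_add_vec:
  "v \<in> carrier_vec d \<Longrightarrow> w \<in> carrier_vec d \<Longrightarrow> act f (v + w) = act f v + act f w"
  using A by (simp add: act_def mult_add_distrib_mat_vec[of _ d d])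

lemma act_const: "v \<in> carrier_vec d \<Longrightarrow> act [:c:] v = c \<cdot>\<^sub>v v"
  using A by (auto simp: act_def intro!: eq_vecI)

lemma act_X: "act [:0, 1:] v = A *\<^sub>v v"
  by (simp add: act_def poly_mat_X[OF A])

lemma act_1 [simp]: "v \<in> carrier_vec d \<Longrightarrow> act 1 v = v"
  using A by (simp add: act_def)

lemma act_0 [simp]: "v \<in> carrier_vec d \<Longrightarrow> act 0 v = 0\<^sub>v d"
  using A by (auto simp: act_def)

lemma act_commute: "v \<in> carrier_vec d \<Longrightarrow> act f (act g v) = act g (act f v)"
  by (simp add: act_mult[symmetric] mult.commute)

lemma act_zero_vec [simp]: "act f (0\<^sub>v d) = 0\<^sub>v d"
  using A by (auto simp: act_def)

lemma act_diff: "v \<in> carrier_vec d \<Longrightarrow> act (f - g) v = act f v - act g v"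
proof -
  assume v: "v \<in> carrier_vec d"
  have "act f v = act (f - g) v + act g v" using act_add[OF v, of "f - g" g] by simp
  then show ?thesis by auto
qed

lemma act_diff_vec:
  assumes v: "v \<in> carrier_vec d" and w: "w \<in> carrier_vec d"
  shows "act f (v - w) = act f v - act f w"
proof -
  have "v - w + w = v" using v w by auto
  then have "act f v = act f (v - w) + act f w"
    using act_add_vec[of "v - w" w f] v w by simp
  then show ?thesis by auto
qed

lemma act_smult_vec: "v \<in> carrier_vec d \<Longrightarrow> act f (c \<cdot>\<^sub>v v) = c \<cdot>\<^sub>v act f v"
  by (simp add: act_const[symmetric] act_commute[of v f])

lemma act_const_inj:
  assumes "v \<in> carrier_vec d" "w \<in> carrier_vec d" "act [:c:] v = act [:c:] w" "c \<noteq> 0"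
  shows "v = w"
proof (rule eq_vecI)
  fix i assume "i < dim_vec w"
  moreover have "c \<cdot>\<^sub>v v = c \<cdot>\<^sub>v w" using assms by (simp add: act_const)
  then have "(c \<cdot>\<^sub>v v) $ i = (c \<cdot>\<^sub>v w) $ i" by simp
  ultimately have "c * v $ i = c * w $ i" using assms by simp
  then show "v $ i = w $ i" using assms by simp
qed (use assms in auto)

lemma act_const_eq_0:
  assumes "v \<in> carrier_vec d" "act [:c:] v = 0\<^sub>v d" "c \<noteq> 0"
  shows "v = 0\<^sub>v d"
  using act_const_inj[of v "0\<^sub>v d" c] assms by simp

lemma act_char_poly [simp]: "v \<in> carrier_vec d \<Longrightarrow> act (char_poly A) v = 0\<^sub>v d"
  by (auto simp: act_def cayley_hamilton[OF A])

lemma act_dvd_0: "f dvd g \<Longrightarrow> v \<in> carrier_vec d \<Longrightarrow> act f v = 0\<^sub>v d \<Longrightarrow> act g v = 0\<^sub>v d"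
  by (auto simp: act_mult mult.commute[of f])

text \<open>
  Over the field of rationals the annihilator is generated by an element of least degree. Its primitive
  part still kills v because the lattice is torsion-free; pseudo-division and Gauss's lemma show that
  it generates the annihilator over Z as well.
\<close>

lemma annihilator_principal:
  assumes v: "v \<in> carrier_vec d" "v \<noteq> 0\<^sub>v d"
  obtains g where "\<not> is_unit g" "\<And>h. act h v = 0\<^sub>v d \<Longrightarrow> g dvd h"
proof -
  define I where "I = {h. h \<noteq> 0 \<and> act h v = 0\<^sub>v d}"
  have "char_poly A \<noteq> 0" using degree_monic_char_poly[OF A] by auto
  then have "char_poly A \<in> I" using v by (simp add: I_def)
  then obtain g0 where g0: "g0 \<in> I" and min: "\<And>h. h \<in> I \<Longrightarrow> degree g0 \<le> degree h"
    using ex_has_least_nat[of "\<lambda>h. h \<in> I" _ degree] by blast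
  define g where "g = primitive_part g0"
  have g0_eq: "g0 = [:content g0:] * g" by (simp add: g_def)
  have c0: "content g0 \<noteq> 0" and "g0 \<noteq> 0" using g0 by (auto simp: I_def)
  have g_nz: "g \<noteq> 0" and cg: "content g = 1" and dg: "degree g = degree g0"
    using \<open>g0 \<noteq> 0\<close> by (auto simp: g_def)
  have "act g0 v = act [:content g0:] (act g v)"
    using act_mult[OF v(1), of "[:content g0:]" g] unfolding g0_eq[symmetric] .
  then have "act [:content g0:] (act g v) = 0\<^sub>v d" using g0 by (simp add: I_def)
  then have gv: "act g v = 0\<^sub>v d" by (rule act_const_eq_0[OF act_closed _ c0])
  have "g dvd h" if hv: "act h v = 0\<^sub>v d" for h
  proof -
    obtain q r where qr: "pseudo_divmod h g = (q, r)" by fastforce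
    define c where "c = Polynomial.coeff g (degree g) ^ (Suc (degree h) - degree g)"
    have eq: "Polynomial.smult c h = g * q + r" and r: "r = 0 \<or> degree r < degree g"
      using pseudo_divmod[OF g_nz qr] by (auto simp: c_def)
    have "act r v = act ([:c:] * h - q * g) v" using eq by (simp add: algebra_simps)
    also have "\<dots> = 0\<^sub>v d" using v hv gv by (simp only: act_diff act_mult) auto
    finally have "r \<noteq> 0 \<Longrightarrow> r \<in> I" by (simp add: I_def)
    then have "r = 0" using r min[of r] dg by linarith
    then have "g dvd Polynomial.smult c h" using eq by simp
    then show ?thesis using primitive_dvd_smult[OF cg] g_nz by (auto simp: c_def)
  qed
  moreover have "\<not> is_unit g"
    using act_dvd_0[of g 1 v] gv v by auto
  ultimately show ?thesis using that by blast
qed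

lemma killed_vector_gives_factor:
  assumes "v \<in> carrier_vec d" "v \<noteq> 0\<^sub>v d" "act f v = 0\<^sub>v d"
  obtains P where "Factorial_Ring.irreducible P" "P dvd char_poly A" "P dvd f"
proof -
  obtain g where g: "\<not> is_unit g" "\<And>h. act h v = 0\<^sub>v d \<Longrightarrow> g dvd h"
    using annihilator_principal assms by metis
  have "g dvd char_poly A" "g dvd f" using g assms by auto
  moreover have "char_poly A \<noteq> 0" using degree_monic_char_poly[OF A] by auto
  then have "g \<noteq> 0" using \<open>g dvd char_poly A\<close> by auto
  then obtain P where "prime_elem P" "P dvd g"
    using prime_divisor_exists[of g] g(1) by auto
  ultimately show ?thesis
    using that[of P] by (meson dvd_trans prime_elem_imp_irreducible)
qed

lemma irreducible_factor_kills_vector: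
  assumes P: "Factorial_Ring.irreducible P" "P dvd char_poly A"
  obtains v where "v \<in> carrier_vec d" "v \<noteq> 0\<^sub>v d" "act P v = 0\<^sub>v d"
proof -
  have "degree P > 0"
  proof (rule ccontr)
    assume "\<not> degree P > 0"
    then obtain c where c: "P = [:c:]" using degree_eq_zeroE by auto
    then have "c dvd lead_coeff (char_poly A)" using P by (auto simp: const_poly_dvd_iff)
    then have "is_unit P" using degree_monic_char_poly[OF A] c by auto
    then show False using P by (simp add: irreducible_not_unit)
  qed
  then show ?thesis
    using irreducible_factor_has_kernel[OF A _ P(2)] that by (auto simp: act_def)
qed

end

section \<open>Ascending chains of sublattices\<close>

definition int_submodule :: "nat \<Rightarrow> int vec set \<Rightarrow> bool" where
  "int_submodule d S \<longleftrightarrow> S \<subseteq> carrier_vec d \<and> 0\<^sub>v d \<in> S \<and>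
     (\<forall>x\<in>S. \<forall>y\<in>S. x + y \<in> S) \<and> (\<forall>c. \<forall>x\<in>S. c \<cdot>\<^sub>v x \<in> S)"

lemma int_submodule_diff:
  assumes "int_submodule d S" "x \<in> S" "y \<in> S"
  shows "x - y \<in> S"
proof -
  have "x + (-1) \<cdot>\<^sub>v y \<in> S" using assms by (simp add: int_submodule_def)
  moreover have "x + (-1) \<cdot>\<^sub>v y = x - y" using assms by (auto simp: int_submodule_def)
  ultimately show ?thesis by simp
qed

text \<open>
  The usual induction on the number m of coordinates that may be nonzero: a vector of S whose last
  such coordinate has the least positive absolute value, together with generators of the part of S where
  that coordinate vanishes, generates S. Generation is expressed by the property that is used later, that
  every submodule containing B contains S.
\<close>

lemma int_submodule_finitely_generated:
  assumes "int_submodule d S" "m \<le> d" "\<And>x i. x \<in> S \<Longrightarrow> m \<le> i \<Longrightarrow> i < d \<Longrightarrow> x $ i = 0"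
  shows "\<exists>B. finite B \<and> B \<subseteq> S \<and> (\<forall>T. int_submodule d T \<and> B \<subseteq> T \<longrightarrow> S \<subseteq> T)"
  using assms
proof (induction m arbitrary: S)
  case 0
  then have "S \<subseteq> {0\<^sub>v d}" by (auto simp: int_submodule_def intro!: eq_vecI)
  then show ?case by (intro exI[of _ "{}"]) (auto simp: int_submodule_def)
next
  case (Suc m)
  have S: "S \<subseteq> carrier_vec d" using Suc.prems(1) by (simp add: int_submodule_def)
  define S0 where "S0 = {x \<in> S. x $ m = 0}"
  have sub0: "int_submodule d S0"
    using Suc.prems(1,2) S by (auto simp: S0_def int_submodule_def subset_iff)
  have "\<exists>B. finite B \<and> B \<subseteq> S0 \<and> (\<forall>T. int_submodule d T \<and> B \<subseteq> T \<longrightarrow> S0 \<subseteq> T)"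
  proof (rule Suc.IH[OF sub0])
    fix x i assume "x \<in> S0" "m \<le> i" "i < d"
    then show "x $ i = 0" using Suc.prems(3)[of x i] by (cases "i = m") (auto simp: S0_def)
  qed (use Suc.prems in simp)
  then obtain B where B: "finite B" "B \<subseteq> S0" "\<forall>T. int_submodule d T \<and> B \<subseteq> T \<longrightarrow> S0 \<subseteq> T"
    by (elim exE conjE)
  show ?case
  proof (cases "S \<subseteq> S0")
    case True
    then have "S = S0" by (auto simp: S0_def)
    then show ?thesis using B by blast
  next
    case False
    then have "\<exists>x. x \<in> S \<and> x $ m \<noteq> 0" by (auto simp: S0_def)
    then obtain v where v: "v \<in> S" "v $ m \<noteq> 0"
      and min: "\<And>x. x \<in> S \<and> x $ m \<noteq> 0 \<Longrightarrow> nat \<bar>v $ m\<bar> \<le> nat \<bar>x $ m\<bar>"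
      using ex_has_least_nat[of "\<lambda>x. x \<in> S \<and> x $ m \<noteq> 0" _ "\<lambda>x. nat \<bar>x $ m\<bar>"] by blast
    have "S \<subseteq> T" if T: "int_submodule d T" and BT: "insert v B \<subseteq> T" for T
    proof
      fix x assume x: "x \<in> S"
      define y where "y = x - (x $ m div v $ m) \<cdot>\<^sub>v v"
      have yS: "y \<in> S" unfolding y_def
        using Suc.prems(1) x v by (intro int_submodule_diff) (auto simp: int_submodule_def)
      have "y $ m = x $ m mod v $ m"
        using Suc.prems(2) S x v by (auto simp: y_def minus_div_mult_eq_mod)
      then have "\<bar>y $ m\<bar> < \<bar>v $ m\<bar>" using abs_mod_less[OF v(2)] by simp
      moreover have "y $ m \<noteq> 0 \<Longrightarrow> nat \<bar>v $ m\<bar> \<le> nat \<bar>y $ m\<bar>" using min[of y] yS by blast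
      ultimately have "y $ m = 0" by linarith
      then have "y \<in> T" using B(3) T BT yS by (auto simp: S0_def)
      then have "y + (x $ m div v $ m) \<cdot>\<^sub>v v \<in> T" using T BT by (auto simp: int_submodule_def)
      moreover have "y + (x $ m div v $ m) \<cdot>\<^sub>v v = x"
        using subsetD[OF S x] subsetD[OF S v(1)] by (auto simp: y_def intro!: eq_vecI)
      ultimately show "x \<in> T" by simp
    qed
    then show ?thesis
      using B(1,2) v(1) by (intro exI[of _ "insert v B"]) (auto simp: S0_def)
  qed
qed

lemma int_submodule_ascending_chain:
  assumes sub: "\<And>k. int_submodule d (S k)" and mono: "\<And>k. S k \<subseteq> S (Suc k)"
  obtains k where "\<And>j. S j \<subseteq> S k"
proof -
  have mono': "S i \<subseteq> S j" if "i \<le> j" for i j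
    using lift_Suc_mono_le[of S, OF mono that] .
  have "int_submodule d (\<Union>k. S k)"
    unfolding int_submodule_def
  proof (intro conjI ballI allI)
    fix x y assume "x \<in> (\<Union>k. S k)" "y \<in> (\<Union>k. S k)"
    then obtain i j where "x \<in> S i" "y \<in> S j" by auto
    then have "x \<in> S (max i j)" "y \<in> S (max i j)"
      using mono'[of i "max i j"] mono'[of j "max i j"] by auto
    then show "x + y \<in> (\<Union>k. S k)" using sub by (auto simp: int_submodule_def)
  next
    show "(\<Union>k. S k) \<subseteq> carrier_vec d" using sub unfolding int_submodule_def by blast
    show "0\<^sub>v d \<in> (\<Union>k. S k)" using sub unfolding int_submodule_def by blast
    fix c x assume "x \<in> (\<Union>k. S k)"
    then show "c \<cdot>\<^sub>v x \<in> (\<Union>k. S k)" using sub unfolding int_submodule_def by blast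
  qed
  then have "\<exists>B. finite B \<and> B \<subseteq> (\<Union>k. S k) \<and>
      (\<forall>T. int_submodule d T \<and> B \<subseteq> T \<longrightarrow> (\<Union>k. S k) \<subseteq> T)"
    by (rule int_submodule_finitely_generated[of _ _ d]) auto
  then obtain B where B: "finite B" "B \<subseteq> (\<Union>k. S k)"
    "\<forall>T. int_submodule d T \<and> B \<subseteq> T \<longrightarrow> (\<Union>k. S k) \<subseteq> T"
    by (elim exE conjE)
  have "\<exists>k. B \<subseteq> S k" using B(1,2)
  proof (induction B)
    case (insert x B)
    then obtain i j where "B \<subseteq> S i" "x \<in> S j" by auto
    then have "insert x B \<subseteq> S (max i j)" using mono'[of i "max i j"] mono'[of j "max i j"] by auto
    then show ?case by blast
  qed auto
  then obtain k where "B \<subseteq> S k" by blast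
  then have "(\<Union>k. S k) \<subseteq> S k" using B(3) sub by simp
  then show ?thesis by (intro that[of k]) auto
qed

section \<open>The intersection of the powers of the ideal generated by t - 1 and p\<close>

text \<open>
  Reduced modulo p, this writes f as a power of t - 1 times a factor that does not vanish at 1.
\<close>

lemma split_off_root_one:
  fixes f :: "int poly"
  assumes p: "prime (p :: int)" and "\<not> [:p:] dvd f"
  obtains l g r where "f = [:-1, 1:] ^ l * g + [:p:] * r" "\<not> p dvd poly g 1"
proof -
  have "\<exists>l g r. f = [:-1, 1:] ^ l * g + [:p:] * r \<and> \<not> p dvd poly g 1"
    using assms(2)
  proof (induction "degree f" arbitrary: f rule: less_induct)
    case less
    show ?case
    proof (cases "p dvd poly f 1")
      case False
      then show ?thesis by (intro exI[of _ 0] exI[of _ f] exI[of _ 0]) simp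
    next
      case True
      then obtain c where c: "poly f 1 = p * c" by (rule dvdE)
      define q where "q = synthetic_div f 1"
      have fq: "f = [:-1, 1:] * q + [:p:] * [:c:]"
        using synthetic_div_correct'[of 1 f] c by (simp add: q_def mult.commute)

      have "degree f \<noteq> 0"
      proof
        assume "degree f = 0"
        then obtain a where "f = [:a:]" using degree_eq_zeroE by blast
        then show False using True less.prems by simp
      qed
      then have "degree q < degree f" by (simp add: q_def degree_synthetic_div)
      moreover have "\<not> [:p:] dvd q"
        using less.prems fq by (metis dvd_add dvd_mult dvd_triv_left)
      ultimately obtain l g r where "q = [:-1, 1:] ^ l * g + [:p:] * r" "\<not> p dvd poly g 1"
        using less.hyps by blast
      then have "f = [:-1, 1:] ^ Suc l * g + [:p:] * ([:-1, 1:] * r + [:c:])"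
        using fq by (simp only: power_Suc distrib_left mult_ac add_ac)
      then show ?thesis using \<open>\<not> p dvd poly g 1\<close> by blast
    qed
  qed
  then show ?thesis using that by blast
qed

context int_matrix
begin

text \<open>
  The submodules s^m V + p^n V, with s = t - 1. Those with m = n have the same intersection as the
  submodules I^n V, where I = (s, p); two separate exponents are convenient in the proof about that
  intersection.
\<close>

definition filtration :: "int \<Rightarrow> nat \<Rightarrow> nat \<Rightarrow> int vec set" where
  "filtration p m n = {act ([:-1, 1:] ^ m) a + act [:p ^ n:] b | a b.
     a \<in> carrier_vec d \<and> b \<in> carrier_vec d}"

lemma filtration_carrier: "filtration p m n \<subseteq> carrier_vec d"
  by (auto simp: filtration_def)

lemma filtrationI:
  "a \<in> carrier_vec d \<Longrightarrow> b \<in> carrier_vec d \<Longrightarrow>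
     act ([:-1, 1:] ^ m) a + act [:p ^ n:] b \<in> filtration p m n"
  by (auto simp: filtration_def)

lemma filtration_act:
  assumes "v \<in> filtration p m n"
  shows "act f v \<in> filtration p m n"
proof -
  obtain a b where ab: "a \<in> carrier_vec d" "b \<in> carrier_vec d"
    "v = act ([:-1, 1:] ^ m) a + act [:p ^ n:] b"
    using assms by (auto simp: filtration_def)
  then have "act f v = act ([:-1, 1:] ^ m) (act f a) + act [:p ^ n:] (act f b)"
    by (simp add: act_add_vec act_commute[of _ f])
  then show ?thesis using filtrationI[of "act f a" "act f b"] by simp
qed

lemma filtration_add:
  assumes "v \<in> filtration p m n" "w \<in> filtration p m n"
  shows "v + w \<in> filtration p m n"
proof -
  obtain a b where ab: "a \<in> carrier_vec d" "b \<in> carrier_vec d"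
    "v = act ([:-1, 1:] ^ m) a + act [:p ^ n:] b"
    using assms by (auto simp: filtration_def)
  obtain a' b' where ab': "a' \<in> carrier_vec d" "b' \<in> carrier_vec d"
    "w = act ([:-1, 1:] ^ m) a' + act [:p ^ n:] b'"
    using assms by (auto simp: filtration_def)
  have "v + w = act ([:-1, 1:] ^ m) (a + a') + act [:p ^ n:] (b + b')"
    using ab ab' by (auto simp: act_add_vec intro!: eq_vecI)
  then show ?thesis using filtrationI[of "a + a'" "b + b'"] ab ab' by simp
qed

lemma filtration_antimono:
  assumes "m \<le> m'" "n \<le> n'"
  shows "filtration p m' n' \<subseteq> filtration p m n"
proof
  fix v assume "v \<in> filtration p m' n'"
  then obtain a b where ab: "a \<in> carrier_vec d" "b \<in> carrier_vec d"
    "v = act ([:-1, 1:] ^ m') a + act [:p ^ n':] b"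
    by (auto simp: filtration_def)
  have "[:-1, 1:] ^ m' = [:-1, 1:] ^ m * [:-1, 1 :: int:] ^ (m' - m)"
    "[:p ^ n':] = [:p ^ n:] * [:p ^ (n' - n):]"
    using assms by (simp_all flip: power_add)
  then have "v = act ([:-1, 1:] ^ m) (act ([:-1, 1:] ^ (m' - m)) a) +
      act [:p ^ n:] (act [:p ^ (n' - n):] b)"
    using ab by (simp only: act_mult)
  then show "v \<in> filtration p m n" using filtrationI by simp
qed

lemma act_multiples_submodule:
  "int_submodule d {u \<in> carrier_vec d. \<exists>b\<in>carrier_vec d. act f u = act g b}"
  unfolding int_submodule_def
proof (intro conjI ballI allI)
  fix x y assume "x \<in> {u \<in> carrier_vec d. \<exists>b\<in>carrier_vec d. act f u = act g b}"
    "y \<in> {u \<in> carrier_vec d. \<exists>b\<in>carrier_vec d. act f u = act g b}"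
  then obtain b b' where "x \<in> carrier_vec d" "b \<in> carrier_vec d" "act f x = act g b"
    "y \<in> carrier_vec d" "b' \<in> carrier_vec d" "act f y = act g b'" by auto
  then show "x + y \<in> {u \<in> carrier_vec d. \<exists>b\<in>carrier_vec d. act f u = act g b}"
    by (auto simp: act_add_vec intro!: bexI[of _ "b + b'"])
next
  fix c x assume "x \<in> {u \<in> carrier_vec d. \<exists>b\<in>carrier_vec d. act f u = act g b}"
  then obtain b where "x \<in> carrier_vec d" "b \<in> carrier_vec d" "act f x = act g b" by auto
  then show "c \<cdot>\<^sub>v x \<in> {u \<in> carrier_vec d. \<exists>b\<in>carrier_vec d. act f u = act g b}"
    by (auto simp: act_smult_vec intro!: bexI[of _ "c \<cdot>\<^sub>v b"])
qed (auto intro!: bexI[of _ "0\<^sub>v d"])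

text \<open>
  Let W be the intersection. It has two properties: an element of V is in W as soon as its multiple by p
  is (\<open>pure\<close>), and s is injective on W modulo p V (\<open>inj\<close>). Both hold because the kernels of the
  powers of s on V / p V become stationary, say from s^k0 on. Modulo p the characteristic polynomial is s^l g with g(1) not 0,
  so s^l g maps W into p V. By injectivity g does so too, and then g maps W into p W by purity. Hence
  g / p acts on W. The iterates u_k = (g / p)^k w stay in a lattice, so one of them satisfies an
  equation of integral dependence, by the ascending chain condition. After clearing denominators this
  says that g^k - p h kills w for some k and h; its value at 1 is prime to p, and so w = 0.
\<close>

lemma krull_intersection:
  assumes p: "prime (p :: int)"
    and ann: "\<And>f u. u \<in> carrier_vec d \<Longrightarrow> u \<noteq> 0\<^sub>v d \<Longrightarrow> act f u = 0\<^sub>v d \<Longrightarrow> p dvd poly f 1"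
    and w: "\<And>n. w \<in> filtration p n n"
  shows "w = 0\<^sub>v d"
proof -
  let ?V = "carrier_vec d" and ?s = "[:-1, 1:] :: int poly"
  have p0: "p \<noteq> 0" using p by auto
  define W where "W = (\<Inter>n. filtration p n n)"
  have W_V: "u \<in> ?V" if "u \<in> W" for u
    using that filtration_carrier[of p 0 0] unfolding W_def by blast
  have W_fil: "u \<in> filtration p m n" if "u \<in> W" for u m n
    using that filtration_antimono[of m "max m n" n "max m n" p] by (auto simp: W_def)
  have W_act: "act f u \<in> W" if "u \<in> W" for f u
    using that filtration_act by (auto simp: W_def)
  (* Stabilisation of the kernels of the powers of s modulo p. *)
  obtain k0 where k0: "\<And>m a. a \<in> ?V \<Longrightarrow> \<exists>b\<in>?V. act (?s ^ m) a = act [:p:] b \<Longrightarrow>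
      \<exists>b\<in>?V. act (?s ^ k0) a = act [:p:] b"
  proof -
    define K where "K m = {u \<in> ?V. \<exists>b\<in>?V. act (?s ^ m) u = act [:p:] b}" for m
    have "K m \<subseteq> K (Suc m)" for m
    proof
      fix u assume "u \<in> K m"
      then obtain b where u: "u \<in> ?V" "b \<in> ?V" "act (?s ^ m) u = act [:p:] b"
        by (auto simp: K_def)
      then have "act (?s ^ Suc m) u = act [:p:] (act ?s b)"
        by (simp only: power_Suc act_mult act_commute[of b ?s])
      then show "u \<in> K (Suc m)" using u(1) act_closed by (auto simp only: K_def)
    qed
    moreover have "int_submodule d (K m)" for m
      unfolding K_def by (rule act_multiples_submodule)
    ultimately obtain k where "\<And>j. K j \<subseteq> K k" using int_submodule_ascending_chain by blast
    then show ?thesis using that[of k] by (auto simp: K_def subset_iff)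
  qed
  have pure: "v \<in> W" if v: "v \<in> ?V" and pv: "act [:p:] v \<in> W" for v
    unfolding W_def
  proof
    fix n
    obtain a b where ab: "a \<in> ?V" "b \<in> ?V"
      "act [:p:] v = act (?s ^ (n + k0)) a + act [:p ^ Suc n:] b"
      using W_fil[OF pv, of "n + k0" "Suc n"] unfolding filtration_def by blast
    have "[:p ^ Suc n:] = [:p:] * [:p ^ n:]" by simp
    then have pb: "act [:p ^ Suc n:] b = act [:p:] (act [:p ^ n:] b)"
      using ab by (simp only: act_mult)
    have "act (?s ^ (n + k0)) a = act [:p:] v - act [:p:] (act [:p ^ n:] b)"
      unfolding ab(3) pb by auto
    also have "\<dots> = act [:p:] (v - act [:p ^ n:] b)"
      using v by (simp add: act_diff_vec)
    finally have ex: "\<exists>b\<in>?V. act (?s ^ (n + k0)) a = act [:p:] b"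
      by (rule bexI) (use v in simp)
    from k0[OF ab(1) ex] obtain c where c: "c \<in> ?V" "act (?s ^ k0) a = act [:p:] c"
      by (rule bexE)
    have "act (?s ^ (n + k0)) a = act [:p:] (act (?s ^ n) c)"
      using ab c by (simp only: power_add act_mult act_commute[of c "?s ^ n"])
    then have eq: "act [:p:] v = act [:p:] (act (?s ^ n) c + act [:p ^ n:] b)"
      using ab(3) pb by (simp add: act_add_vec)
    have "v = act (?s ^ n) c + act [:p ^ n:] b"
      by (rule act_const_inj[OF v _ eq p0]) simp
    then show "v \<in> filtration p n n" using filtrationI[of c b n p n] c ab by simp
  qed
  have inj: "\<exists>b\<in>?V. u = act [:p:] b"
    if u: "u \<in> W" and b: "b \<in> ?V" "act (?s ^ l) u = act [:p:] b" for u l b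
  proof -
    obtain a e where ae: "a \<in> ?V" "e \<in> ?V" "u = act (?s ^ k0) a + act [:p ^ 1:] e"
      using W_fil[OF u, of k0 1] unfolding filtration_def by blast
    have "act (?s ^ k0) a = u - act [:p:] e" unfolding ae(3) by auto
    then have "act (?s ^ (l + k0)) a = act (?s ^ l) (u - act [:p:] e)"
      using ae(1) by (simp add: power_add act_mult)
    also have "\<dots> = act [:p:] (b - act (?s ^ l) e)"
      using ae b u W_V by (simp add: act_diff_vec act_commute[of e])
    finally have ex: "\<exists>b\<in>?V. act (?s ^ (l + k0)) a = act [:p:] b"
      by (rule bexI) (use b in simp)
    from k0[OF ae(1) ex] obtain c where c: "c \<in> ?V" "act (?s ^ k0) a = act [:p:] c"
      by (rule bexE)
    then have "u = act [:p:] (c + e)" using ae by (simp add: act_add_vec)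
    then show ?thesis using c ae by (intro bexI[of _ "c + e"]) simp_all
  qed
  have "lead_coeff (char_poly A) = 1" using degree_monic_char_poly[OF A] by simp
  then have "\<not> [:p:] dvd char_poly A"
    using p by (metis const_poly_dvd_iff not_prime_unit)
  then obtain l g r where chi: "char_poly A = ?s ^ l * g + [:p:] * r" and g: "\<not> p dvd poly g 1"
    using split_off_root_one[OF p] by blast
  have gW: "\<exists>u'\<in>W. act g u = act [:p:] u'" if u: "u \<in> W" for u
  proof -
    have uV: "u \<in> ?V" using u W_V by blast
    have "?s ^ l * g = char_poly A - [:p:] * r" by (simp add: chi)
    then have "act (?s ^ l) (act g u) = act (char_poly A - [:p:] * r) u"
      using uV by (simp only: act_mult flip: act_mult)
    also have "\<dots> = act [:p:] (0\<^sub>v d - act r u)"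
      using uV by (simp only: act_diff act_mult act_char_poly act_diff_vec act_zero_vec act_closed zero_carrier_vec)
    finally obtain b where "b \<in> ?V" "act g u = act [:p:] b"
      using inj[OF W_act[OF u], of "0\<^sub>v d - act r u" l g] by auto
    then show ?thesis using pure[of b] W_act[OF u, of g] by auto
  qed
  have wW: "w \<in> W" using w by (simp add: W_def)
  then have wV: "w \<in> ?V" by (rule W_V)
  (* The iterates of g / p, defined without dividing: u plays the role of g^k w / p^k. *)
  have divided: "\<exists>u\<in>W. act [:p ^ k:] u = act (g ^ k) w" for k
  proof (induction k)
    case 0
    have "[:p ^ 0:] = (1 :: int poly)" by simp
    then show ?case using wW wV by (intro bexI[of _ w]) (simp_all only: power_0 act_1)
  next
    case (Suc k)
    then obtain u where u: "u \<in> W" "act [:p ^ k:] u = act (g ^ k) w" by blast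
    obtain u' where u': "u' \<in> W" "act g u = act [:p:] u'" using gW[OF u(1)] by blast
    have uV: "u \<in> ?V" "u' \<in> ?V" using u u' W_V by auto
    have "[:p ^ Suc k:] = [:p ^ k:] * [:p:]" by simp
    then have "act [:p ^ Suc k:] u' = act [:p ^ k:] (act g u)"
      using uV u' by (simp only: act_mult)
    also have "\<dots> = act g (act (g ^ k) w)" 
      by (simp only: act_commute[OF uV(1), of "[:p ^ k:]" g] u(2))
    also have "\<dots> = act (g ^ Suc k) w" using wV by (simp add: act_mult)
    finally show ?case using u' by blast
  qed
  (* The submodule S k contains the iterates u_i with i < k, because p^k u_i = p^(k-i) g^i w.
     Membership in it records only that p^k u is a multiple of p in the module generated by w. *)
  define S where "S k = {u \<in> ?V. \<exists>h. act [:p ^ k:] u = act ([:p:] * h) w}" for k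
  have S_I: "u \<in> S k" if "u \<in> ?V" "act [:p ^ k:] u = act ([:p:] * h) w" for u k h
    using that unfolding S_def by blast
  have S_sub: "int_submodule d (S k)" for k
    unfolding int_submodule_def
  proof (intro conjI ballI allI)
    show "0\<^sub>v d \<in> S k" using wV by (auto simp: S_def intro!: exI[of _ 0])
    fix x y assume "x \<in> S k" "y \<in> S k"
    then obtain h h' where x: "x \<in> ?V" "act [:p ^ k:] x = act ([:p:] * h) w"
      and y: "y \<in> ?V" "act [:p ^ k:] y = act ([:p:] * h') w" by (auto simp only: S_def)
    then have eq: "act [:p ^ k:] (x + y) = act ([:p:] * (h + h')) w"
      using wV by (simp only: act_add_vec act_add distrib_left)
    show "x + y \<in> S k" by (rule S_I[OF _ eq]) (use x y in simp)
  next
    fix c x assume "x \<in> S k"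
    then obtain h where x: "x \<in> ?V" "act [:p ^ k:] x = act ([:p:] * h) w"
      by (auto simp only: S_def)
    then have eq: "act [:p ^ k:] (c \<cdot>\<^sub>v x) = act ([:p:] * ([:c:] * h)) w"
      using wV by (simp only: act_smult_vec mult.left_commute[of _ "[:c:]"] act_mult[OF wV, of "[:c:]"] act_const act_closed)
    show "c \<cdot>\<^sub>v x \<in> S k" by (rule S_I[OF _ eq]) (use x in simp)
  qed (auto simp: S_def)
  have S_mono: "S k \<subseteq> S (Suc k)" for k
  proof
    fix x assume "x \<in> S k"
    then obtain h where x: "x \<in> ?V" "act [:p ^ k:] x = act ([:p:] * h) w"
      by (auto simp only: S_def)
    have "[:p ^ Suc k:] = [:p:] * [:p ^ k:]" by simp
    then have eq: "act [:p ^ Suc k:] x = act ([:p:] * ([:p:] * h)) w"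
      using x wV by (simp only: act_mult)
    show "x \<in> S (Suc k)" by (rule S_I[OF _ eq]) (use x in simp)
  qed
  obtain k where k: "\<And>j. S j \<subseteq> S k"
    using int_submodule_ascending_chain[of d S, OF S_sub S_mono] by blast
  obtain u where u: "u \<in> W" "act [:p ^ k:] u = act (g ^ k) w" using divided by blast
  have "[:p ^ Suc k:] = [:p:] * [:p ^ k:]" by simp
  then have "act [:p ^ Suc k:] u = act ([:p:] * g ^ k) w"
    using u W_V wV by (simp only: act_mult)
  then have "u \<in> S (Suc k)" using u(1) W_V by (intro S_I[of u "Suc k" "g ^ k"])
  then have "u \<in> S k" using k by blast
  then obtain h where h: "act [:p ^ k:] u = act ([:p:] * h) w" by (auto simp only: S_def)
  have "act (g ^ k - [:p:] * h) w = 0\<^sub>v d"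
    using h u wV by (simp add: act_diff)
  moreover have "\<not> p dvd poly (g ^ k - [:p:] * h) 1"
  proof
    assume "p dvd poly (g ^ k - [:p:] * h) 1"
    then have "p dvd poly g 1 ^ k - p * poly h 1" by simp
    then have "p dvd (poly g 1 ^ k - p * poly h 1) + p * poly h 1" by (intro dvd_add) auto
    then have "p dvd poly g 1 ^ k" by simp
    then show False using g p by (metis prime_dvd_power)
  qed
  ultimately show ?thesis using ann wV by blast
qed

end

section \<open>Congruences for powers near one\<close>

lemma freshmans_dream_dvd:
  fixes a b :: "'a::comm_ring_1"
  assumes p: "prime (p :: nat)"
  shows "of_nat p dvd (a + b) ^ p - (a ^ p + b ^ p)"
proof -
  let ?f = "\<lambda>k. of_nat (p choose k) * a ^ k * b ^ (p - k) :: 'a"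
  have "p > 0" using p prime_gt_0_nat by blast
  have set: "{..p} = insert 0 (insert p {0<..<p})" by auto
  have "(a + b) ^ p = (\<Sum>k\<le>p. ?f k)" by (rule binomial_ring)
  also have "\<dots> = ?f 0 + (?f p + (\<Sum>k\<in>{0<..<p}. ?f k))"
    unfolding set using \<open>p > 0\<close> by (subst sum.insert, simp, simp)+ simp
  finally have "(a + b) ^ p - (a ^ p + b ^ p) = (\<Sum>k\<in>{0<..<p}. ?f k)"
    using \<open>p > 0\<close> by (simp add: algebra_simps)
  moreover have "of_nat p dvd ?f k" if "k \<in> {0<..<p}" for k
  proof -
    have "p dvd (p choose k)" using that p \<open>p > 0\<close> by (intro dvd_choose_prime) auto
    then obtain c where "p choose k = p * c" by (rule dvdE)
    then have "of_nat (p choose k) = of_nat p * (of_nat c :: 'a)" by simp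
    then show ?thesis by (simp add: mult.assoc)
  qed
  ultimately show ?thesis by (simp only:) (rule dvd_sum)
qed

lemma freshmans_dream_power_dvd:
  fixes a b :: "'a::comm_ring_1"
  assumes p: "prime (p :: nat)"
  shows "of_nat p dvd (a + b) ^ (p ^ j) - (a ^ (p ^ j) + b ^ (p ^ j))"
proof (induction j)
  case (Suc j)
  let ?x = "(a + b) ^ (p ^ j)" and ?y = "a ^ (p ^ j)" and ?z = "b ^ (p ^ j)"
  have "?x - (?y + ?z) dvd ?x ^ p - (?y + ?z) ^ p"
    using power_diff_sumr2[of ?x p "?y + ?z"] by simp
  then have "of_nat p dvd ?x ^ p - (?y + ?z) ^ p" using Suc.IH dvd_trans by blast
  then have "of_nat p dvd (?x ^ p - (?y + ?z) ^ p) + ((?y + ?z) ^ p - (?y ^ p + ?z ^ p))"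
    by (intro dvd_add freshmans_dream_dvd[OF p])
  moreover have "(?x ^ p - (?y + ?z) ^ p) + ((?y + ?z) ^ p - (?y ^ p + ?z ^ p)) =
      ?x ^ p - (?y ^ p + ?z ^ p)"
    by (simp only: add_diff_eq diff_add_cancel)
  ultimately have "of_nat p dvd ?x ^ p - (?y ^ p + ?z ^ p)" by (simp only:)
  then show ?case by (simp add: power_mult[symmetric] mult.commute)
qed simp

text \<open>
  One step of p-adic lifting modulo s: if y is 1 modulo p^k, then in y^p - 1 = (y - 1)(1 + ... + y^(p-1))
  the second factor is divisible by p, since all its p summands are 1 modulo p.
\<close>

lemma pth_power_near_one:
  fixes s r q :: "'a::comm_ring_1"
  assumes "k > 0"
  obtains r' q' where "(1 + s * r + of_nat p ^ k * q) ^ p = 1 + s * r' + of_nat p ^ Suc k * q'"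
proof -
  let ?p = "of_nat p :: 'a"
  let ?x = "1 + s * r + ?p ^ k * q" and ?y = "1 + ?p ^ k * q"
  have "?x - ?y dvd ?x ^ p - ?y ^ p"
    using power_diff_sumr2[of ?x p ?y] by simp
  then obtain c where c: "?x ^ p - ?y ^ p = s * r * c" by (auto simp: dvd_def)
  have "?p dvd ?y ^ j - 1" for j
  proof -
    have "?y - 1 dvd ?y ^ j - 1" using power_diff_1_eq[of ?y j] by (cases j) auto
    moreover have "?p dvd ?y - 1" using assms by (cases k) auto
    ultimately show ?thesis using dvd_trans by blast
  qed
  then have "?p dvd (\<Sum>j<p. ?y ^ j - 1) + ?p" by (intro dvd_add dvd_sum) auto
  then have "?p dvd (\<Sum>j<p. ?y ^ j)" by (simp add: sum_subtractf)
  then obtain e where e: "(\<Sum>j<p. ?y ^ j) = ?p * e" by auto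
  have "?y ^ p - 1 = (?y - 1) * (\<Sum>j<p. ?y ^ j)" by (rule power_diff_1_eq)
  then have "?y ^ p - 1 = ?p ^ Suc k * (q * e)" unfolding e by (simp add: algebra_simps)
  then have "?x ^ p = 1 + s * (r * c) + ?p ^ Suc k * (q * e)"
    using c by (simp add: algebra_simps)
  then show ?thesis using that by blast
qed

text \<open>
  Modulo p, the power of t with exponent p^n is 1 + (t - 1)^(p^n). This is 1 modulo (t - 1)^n and p, and
  raising to the p-th power repeatedly improves p to p^n. With t acting as an automorphism of V, this
  is why its order on V / ((t - 1)^n V + p^n V) is a power of p.
\<close>

lemma power_near_one:
  fixes t :: "'a::comm_ring_1"
  assumes p: "prime (p :: nat)"
  obtains M r q where "t ^ (p ^ M) = 1 + (t - 1) ^ n * r + of_nat p ^ n * q"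
proof -
  have "\<exists>M r q. t ^ (p ^ M) = 1 + (t - 1) ^ n * r + of_nat p ^ Suc k * q" for k
  proof (induction k)
    case 0
    have "n \<le> p ^ n" using p by (meson less_imp_le less_exp power_mono prime_ge_2_nat zero_le order_trans)
    then have s: "(t - 1) ^ p ^ n = (t - 1) ^ n * (t - 1) ^ (p ^ n - n)"
      by (simp flip: power_add)
    obtain q where "(t - 1 + 1) ^ (p ^ n) - ((t - 1) ^ (p ^ n) + 1 ^ (p ^ n)) = of_nat p * q"
      using freshmans_dream_power_dvd[OF p, of "t - 1" 1 n] by auto
    then have "t ^ (p ^ n) = 1 + (t - 1) ^ n * (t - 1) ^ (p ^ n - n) + of_nat p ^ Suc 0 * q"
      by (simp add: s algebra_simps)
    then show ?case by blast
  next
    case (Suc k)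
    then obtain M r q where M: "t ^ (p ^ M) = 1 + (t - 1) ^ n * r + of_nat p ^ Suc k * q" by blast
    obtain r' q' where "(t ^ (p ^ M)) ^ p = 1 + (t - 1) ^ n * r' + of_nat p ^ Suc (Suc k) * q'"
      unfolding M using pth_power_near_one[of "Suc k"] by blast
    then have "t ^ (p ^ Suc M) = 1 + (t - 1) ^ n * r' + of_nat p ^ Suc (Suc k) * q'"
      by (simp add: power_mult[symmetric] mult.commute)
    then show ?case by blast
  qed
  then obtain M r q where "t ^ (p ^ M) = 1 + (t - 1) ^ n * r + of_nat p ^ n * (of_nat p * q)"
    by (metis mult.assoc power_Suc2)
  then show ?thesis using that by blast
qed

text \<open>
  Put c = f(1), q = p^M and f = s h + c with s = t - 1. Freshman's dream gives f^q = s^q h^q + c^q and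
  s^q = t^q - 1 modulo p, so c^q is in the ideal (f, t^q - 1) up to a multiple of p. Raising this to the
  M-th power turns the error into a multiple of p^M.
\<close>

lemma value_at_one_combination:
  fixes f :: "int poly"
  assumes p: "prime (p :: nat)"
  obtains a b e where
    "[:poly f 1 ^ (p ^ M * M):] = a * f + b * ([:0, 1:] ^ (p ^ M) - 1) + [:int p ^ M:] * e"
proof -
  let ?q = "p ^ M" and ?t = "[:0, 1:] :: int poly" and ?s = "[:-1, 1:] :: int poly"
  let ?p = "of_nat p :: int poly"
  define c where "c = [:poly f 1:]"
  obtain h where h: "f = ?s * h + c"
    using synthetic_div_correct'[of 1 f] by (metis c_def)
  obtain r1 where r1: "(?s * h + c) ^ ?q - ((?s * h) ^ ?q + c ^ ?q) = ?p * r1"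
    using freshmans_dream_power_dvd[OF p] by (rule dvdE)
  obtain r2 where r2: "(?s + 1) ^ ?q - (?s ^ ?q + 1 ^ ?q) = ?p * r2"
    using freshmans_dream_power_dvd[OF p] by (rule dvdE)
  have "?s + 1 = ?t" by (simp add: one_pCons)
  then have s: "?s ^ ?q = ?t ^ ?q - 1 - ?p * r2" using r2 by (simp add: algebra_simps)
  define X where "X = f ^ ?q - (?t ^ ?q - 1) * h ^ ?q"
  define e where "e = r2 * h ^ ?q - r1"
  have "c ^ ?q = f ^ ?q - ?s ^ ?q * h ^ ?q - ?p * r1"
  proof -
    have *: "C = F - S - R" if "F - (S + C) = R" for C F S R :: "int poly"
      using that by (simp add: algebra_simps)
    show ?thesis using *[OF r1] by (simp only: h[symmetric] power_mult_distrib)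
  qed
  also have "\<dots> = X + ?p * e" unfolding s X_def e_def by (simp add: algebra_simps)
  finally have cq: "c ^ ?q = X + ?p * e" .
  have "(X + ?p * e) - ?p * e dvd (X + ?p * e) ^ M - (?p * e) ^ M"
    using power_diff_sumr2[of "X + ?p * e" M "?p * e"] by simp
  then obtain z where z: "(c ^ ?q) ^ M = X * z + (?p * e) ^ M"
    unfolding cq by (auto simp: dvd_def algebra_simps)
  have "?q > 0" using p prime_gt_0_nat by simp
  then have "f ^ ?q = f * f ^ (?q - 1)" by (cases ?q) auto
  then have "c ^ (?q * M) = (z * f ^ (?q - 1)) * f + (- z * h ^ ?q) * (?t ^ ?q - 1) + ?p ^ M * e ^ M"
    using z unfolding X_def power_mult[of c] by (simp add: power_mult_distrib algebra_simps)
  moreover have "c ^ (?q * M) = [:poly f 1 ^ (p ^ M * M):]" by (simp add: c_def poly_const_pow)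
  moreover have "?p ^ M = [:int p ^ M:]" by (simp add: of_nat_poly poly_const_pow)
  ultimately show ?thesis
    using that[of "z * f ^ (?q - 1)" "- z * h ^ ?q" "e ^ M"] by (simp only:)
qed

section \<open>Finite groups of prime power exponent\<close>

text \<open>
  By Sylow's theorem another prime q dividing the order would give a subgroup of order q, whose
  elements have orders dividing both q and a power of p.
\<close>

lemma p_group_of_p_power_exponent:
  assumes "group Q" and fin: "finite (carrier Q)" and p: "prime (p :: nat)"
    and exp: "\<And>x. x \<in> carrier Q \<Longrightarrow> x [^]\<^bsub>Q\<^esub> (p ^ k) = \<one>\<^bsub>Q\<^esub>"
  shows "p_group p Q"
proof -
  interpret Q: group Q by fact
  have pos: "order Q > 0" using Q.order_gt_0_iff_finite fin by blast
  have only_p: "q = p" if q: "prime q" "q dvd order Q" for q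
  proof (rule ccontr)
    assume "q \<noteq> p"
    obtain m where "order Q = q ^ 1 * m" using q by auto
    then obtain H where H: "subgroup H Q" "card H = q ^ 1"
      using sylow_thm[OF q(1) \<open>group Q\<close> _ fin] by blast
    interpret H: group "Q\<lparr>carrier := H\<rparr>" by (rule Q.subgroup_imp_group[OF H(1)])
    have "\<not> H \<subseteq> {\<one>\<^bsub>Q\<^esub>}"
      using H(2) q(1) prime_ge_2_nat[of q] card_mono[of "{\<one>\<^bsub>Q\<^esub>}" H] by auto
    then obtain x where x: "x \<in> H" "x \<noteq> \<one>\<^bsub>Q\<^esub>" by auto
    then have xQ: "x \<in> carrier Q" using H(1) subgroup.mem_carrier by metis
    have "x [^]\<^bsub>Q\<^esub> q = \<one>\<^bsub>Q\<^esub>"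
      using H.pow_order_eq_1[of x] x H(2) Q.nat_pow_consistent[of x q H] by (simp add: order_def)
    then have "Q.ord x dvd q" "Q.ord x dvd p ^ k"
      using exp[OF xQ] xQ by (simp_all add: Q.pow_eq_id)
    moreover have "coprime q (p ^ k)"
      using \<open>q \<noteq> p\<close> q p by (simp add: primes_coprime)
    ultimately have "Q.ord x = 1" by (metis coprime_common_divisor_nat)
    then show False using x xQ Q.ord_eq_1 by blast
  qed
  obtain m where m: "order Q = p ^ multiplicity p (order Q) * m" "\<not> p dvd m"
    using multiplicity_decompose'[of "order Q" p] pos p by (metis not_prime_unit not_gr0)
  have "m = 1"
  proof (rule ccontr)
    assume "m \<noteq> 1"
    then obtain q where q: "prime q" "q dvd m" using prime_factor_nat by blast
    then have "q dvd order Q" by (subst m(1)) simp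
    then show False using only_p q m(2) by blast
  qed
  then show ?thesis using m(1) \<open>group Q\<close> fin unfolding p_group_def by auto
qed

section \<open>The automorphism and its semidirect product\<close>

text \<open>
  The automorphism is only additive by hypothesis. The first part of this locale shows that it is
  multiplication by its matrix, so that \<open>act\<close> describes its nonnegative powers; \<open>pw\<close> denotes the
  integer powers.
\<close>

locale lattice_auto =
  fixes d :: nat and \<phi> :: "int vec \<Rightarrow> int vec"
  assumes \<phi>: "\<phi> \<in> auto (Zpow d)"
begin

abbreviation "V \<equiv> carrier_vec d :: int vec set"
abbreviation "G \<equiv> semidirect_Z d \<phi>"

definition pw :: "int \<Rightarrow> int vec \<Rightarrow> int vec" where
  "pw i = \<phi> [^]\<^bsub>AutoGroup (Zpow d)\<^esub> i"

lemma group_AutoGroup: "group (AutoGroup (Zpow d))"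
  by (rule group.AutoGroup[OF comm_group.axioms(2)[OF comm_group_vec]])

lemma carrier_AutoGroup: "carrier (AutoGroup (Zpow d)) = auto (Zpow d)"
  by (simp add: AutoGroup_def)

lemma pw_auto: "pw i \<in> auto (Zpow d)"
  using group.int_pow_closed[OF group_AutoGroup, of \<phi> i] \<phi> by (simp add: pw_def carrier_AutoGroup)

lemma pw_closed [simp]: "x \<in> V \<Longrightarrow> pw i x \<in> V"
  using pw_auto[of i] by (auto simp: auto_def hom_def monoid_vec_def Pi_iff)

lemma pw_dim [simp]: "x \<in> V \<Longrightarrow> dim_vec (pw i x) = d"
  using pw_closed by (rule carrier_vecD)

lemma pw_add_vec: "x \<in> V \<Longrightarrow> y \<in> V \<Longrightarrow> pw i (x + y) = pw i x + pw i y"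
  using pw_auto[of i] by (auto simp: auto_def hom_def monoid_vec_def)

lemma pw_pw:
  assumes "x \<in> V"
  shows "pw (i + j) x = pw i (pw j x)"
proof -
  have "pw (i + j) = pw i \<otimes>\<^bsub>AutoGroup (Zpow d)\<^esub> pw j"
    using group.int_pow_mult[OF group_AutoGroup, of \<phi> i j] \<phi> by (simp add: pw_def carrier_AutoGroup)
  moreover have "pw i \<in> Bij V" for i
    using pw_auto[of i] by (simp add: auto_def monoid_vec_def)
  ultimately show ?thesis
    using assms by (simp add: AutoGroup_def BijGroup_def monoid_vec_def compose_def)
qed

lemma pw_0 [simp]: "x \<in> V \<Longrightarrow> pw 0 x = x"
  by (simp add: pw_def AutoGroup_def BijGroup_def monoid_vec_def)

lemma pw_1 [simp]: "pw 1 x = \<phi> x"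
  using group.int_pow_1[OF group_AutoGroup, of \<phi>] \<phi> by (simp add: pw_def carrier_AutoGroup)

lemma pw_inverse [simp]: "x \<in> V \<Longrightarrow> pw (- i) (pw i x) = x" "x \<in> V \<Longrightarrow> pw i (pw (- i) x) = x"
  by (simp_all flip: pw_pw)

lemma \<phi>_closed: "x \<in> V \<Longrightarrow> \<phi> x \<in> V"
  using pw_closed[of x 1] by simp

lemma \<phi>_add: "x \<in> V \<Longrightarrow> y \<in> V \<Longrightarrow> \<phi> (x + y) = \<phi> x + \<phi> y"
  using pw_add_vec[of x y 1] by simp

lemma \<phi>_zero: "\<phi> (0\<^sub>v d) = 0\<^sub>v d"
proof (rule eq_vecI)
  fix i assume "i < dim_vec (0\<^sub>v d :: int vec)"
  moreover have "\<phi> (0\<^sub>v d) + \<phi> (0\<^sub>v d) = \<phi> (0\<^sub>v d)"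
    using \<phi>_add[of "0\<^sub>v d" "0\<^sub>v d"] by simp
  then have "(\<phi> (0\<^sub>v d) + \<phi> (0\<^sub>v d)) $ i = \<phi> (0\<^sub>v d) $ i" by simp
  ultimately show "\<phi> (0\<^sub>v d) $ i = 0\<^sub>v d $ i"
    using \<phi>_closed[of "0\<^sub>v d"] by simp
qed (use \<phi>_closed[of "0\<^sub>v d"] in auto)

lemma \<phi>_smult:
  assumes x: "x \<in> V"
  shows "\<phi> (c \<cdot>\<^sub>v x) = c \<cdot>\<^sub>v \<phi> x"
proof -
  have nat: "\<phi> (int n \<cdot>\<^sub>v y) = int n \<cdot>\<^sub>v \<phi> y" if y: "y \<in> V" for n y
  proof (induction n)
    case 0
    have "int 0 \<cdot>\<^sub>v z = 0\<^sub>v d" if "z \<in> V" for z using that by auto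
    then show ?case using y \<phi>_closed[OF y] \<phi>_zero by metis
  next
    case (Suc n)
    have "int (Suc n) \<cdot>\<^sub>v y = y + int n \<cdot>\<^sub>v y" using y by (auto simp: algebra_simps)
    then show ?case
      using y \<phi>_closed[OF y] Suc \<phi>_add[of y "int n \<cdot>\<^sub>v y"] by (auto simp: algebra_simps)
  qed
  show ?thesis
  proof (cases "c \<ge> 0")
    case True
    then show ?thesis using nat[OF x, of "nat c"] by simp
  next
    case False
    have cx: "c \<cdot>\<^sub>v x \<in> V" using x by simp
    have "c \<cdot>\<^sub>v x + int (nat (- c)) \<cdot>\<^sub>v x = 0\<^sub>v d" using False x by auto
    then have "\<phi> (c \<cdot>\<^sub>v x) + \<phi> (int (nat (- c)) \<cdot>\<^sub>v x) = 0\<^sub>v d"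
      using \<phi>_add[OF cx, of "int (nat (- c)) \<cdot>\<^sub>v x"] x \<phi>_zero by simp
    then have *: "\<phi> (c \<cdot>\<^sub>v x) + (- c) \<cdot>\<^sub>v \<phi> x = 0\<^sub>v d" 
      using False nat[OF x, of "nat (- c)"] by simp
    show ?thesis
    proof (rule eq_vecI)
      fix i assume i: "i < dim_vec (c \<cdot>\<^sub>v \<phi> x)"
      have "(\<phi> (c \<cdot>\<^sub>v x) + (- c) \<cdot>\<^sub>v \<phi> x) $ i = 0" using * i \<phi>_closed[OF x] by simp
      then show "\<phi> (c \<cdot>\<^sub>v x) $ i = (c \<cdot>\<^sub>v \<phi> x) $ i"
        using i \<phi>_closed[OF x] \<phi>_closed[OF cx] by simp
    qed (use \<phi>_closed[OF x] \<phi>_closed[OF cx] in auto)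
  qed
qed

sublocale int_matrix "matrix_of_auto d \<phi>" d
  by unfold_locales (simp add: matrix_of_auto_def)

text \<open>
  Both sides are additive and agree on unit vectors; the induction adds one coordinate at a time.
\<close>

lemma \<phi>_eq_mult_mat_vec:
  assumes v: "v \<in> V"
  shows "\<phi> v = matrix_of_auto d \<phi> *\<^sub>v v"
proof -
  have unit: "\<phi> (unit_vec d j) = matrix_of_auto d \<phi> *\<^sub>v unit_vec d j" if "j < d" for j
    using that \<phi>_closed[of "unit_vec d j"]
    by (intro eq_vecI) (auto simp: matrix_of_auto_def scalar_prod_right_unit)
  have "\<forall>v\<in>V. (\<forall>i<d. m \<le> i \<longrightarrow> v $ i = 0) \<longrightarrow> \<phi> v = matrix_of_auto d \<phi> *\<^sub>v v" if "m \<le> d" for m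
    using that
  proof (induction m)
    case 0
    have "v = 0\<^sub>v d" if "v \<in> V" "\<forall>i<d. 0 \<le> i \<longrightarrow> v $ i = 0" for v
      using that by (intro eq_vecI) auto
    moreover have "matrix_of_auto d \<phi> *\<^sub>v 0\<^sub>v d = 0\<^sub>v d" using A by (intro eq_vecI) auto
    ultimately show ?case using \<phi>_zero by metis
  next
    case (Suc m)
    show ?case
    proof (intro ballI impI)
      fix v assume v: "v \<in> V" "\<forall>i<d. Suc m \<le> i \<longrightarrow> v $ i = 0"
      define u where "u = v - v $ m \<cdot>\<^sub>v unit_vec d m"
      have uV: "u \<in> V" using v by (simp add: u_def)
      have "u $ i = 0" if "i < d" "m \<le> i" for i
        using that v Suc.prems by (cases "i = m") (auto simp: u_def)
      then have u: "\<phi> u = matrix_of_auto d \<phi> *\<^sub>v u" using Suc uV by simp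
      have veq: "v = u + v $ m \<cdot>\<^sub>v unit_vec d m"
        using v by (auto simp: u_def intro!: eq_vecI)
      have "\<phi> v = \<phi> u + v $ m \<cdot>\<^sub>v \<phi> (unit_vec d m)"
        using uV \<phi>_add[of u "v $ m \<cdot>\<^sub>v unit_vec d m"] \<phi>_smult[of "unit_vec d m"] veq by simp
      also have "\<dots> = matrix_of_auto d \<phi> *\<^sub>v (u + v $ m \<cdot>\<^sub>v unit_vec d m)"
        using u unit[of m] Suc.prems uV
        by (simp add: act_add_vec act_smult_vec flip: act_X)
      finally show "\<phi> v = matrix_of_auto d \<phi> *\<^sub>v v" using veq by simp
    qed
  qed
  from this[of d] show ?thesis using v by simp
qed

lemma \<phi>_eq_act: "v \<in> V \<Longrightarrow> \<phi> v = act [:0, 1:] v"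
  by (simp add: act_X \<phi>_eq_mult_mat_vec)

lemma pw_nat: "x \<in> V \<Longrightarrow> pw (int n) x = act ([:0, 1:] ^ n) x"
proof (induction n)
  case (Suc n)
  have "pw (int (Suc n)) x = pw 1 (pw (int n) x)" 
    using pw_pw[OF Suc.prems, of 1 "int n"] by simp
  also have "\<dots> = act ([:0, 1:] ^ Suc n) x"
    unfolding power_Suc act_mult[OF Suc.prems] using Suc by (simp add: \<phi>_eq_act)
  finally show ?case .
qed simp

lemma pw_act:
  assumes x: "x \<in> V"
  shows "pw i (act f x) = act f (pw i x)"
proof -
  have nat: "pw (int n) (act f y) = act f (pw (int n) y)" if "y \<in> V" for n y
    using that by (simp add: pw_nat act_commute)
  show ?thesis
  proof (cases "i \<ge> 0")
    case True
    then show ?thesis using nat[OF x, of "nat i"] by simp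
  next
    case False
    define n where "n = nat (- i)"
    have i: "i = - int n" using False by (simp add: n_def)
    have "act f x = pw (int n) (act f (pw i x))"
      using nat[of "pw i x" n] x by (simp add: i)
    then show ?thesis using x by (simp add: i)
  qed
qed

text \<open>
  The polynomial t^q - 1 divides t^(q n) - 1; negative exponents reduce to positive ones by exchanging
  the two points x and \<open>\<phi>\<close>^(q i) x.
\<close>

lemma pw_minus_id:
  assumes x: "x \<in> V"
  obtains z where "z \<in> V" "pw (int q * i) x - x = act ([:0, 1:] ^ q - 1) z"
proof -
  let ?t = "[:0, 1:] :: int poly"
  have nat: "\<exists>z\<in>V. pw (int q * int n) y - y = act (?t ^ q - 1) z" if y: "y \<in> V" for n y
  proof -
    have "?t ^ q - 1 dvd (?t ^ q) ^ n - 1"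
      using power_diff_sumr2[of "?t ^ q" n 1] by simp
    then obtain c where c: "(?t ^ q) ^ n - 1 = (?t ^ q - 1) * c" by (rule dvdE)
    have "pw (int q * int n) y - y = act ((?t ^ q) ^ n - 1) y"
      using y pw_nat[OF y, of "q * n"] by (simp add: act_diff power_mult)
    also have "\<dots> = act (?t ^ q - 1) (act c y)" unfolding c using y by (simp add: act_mult)
    finally show ?thesis by (intro bexI[of _ "act c y"]) simp_all
  qed
  show ?thesis
  proof (cases "i \<ge> 0")
    case True
    then show ?thesis using nat[OF x, of "nat i"] that by auto
  next
    case False
    define y where "y = pw (int q * i) x"
    have y: "y \<in> V" using x by (simp add: y_def)
    obtain z where z: "z \<in> V" "pw (int q * int (nat (- i))) y - y = act (?t ^ q - 1) z"
      using nat[OF y] by blast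
    have "pw (int q * int (nat (- i))) y = x"
      using False x by (simp add: y_def)
    then have xy: "x - y = act (?t ^ q - 1) z" using z by simp
    have "y - x = 0\<^sub>v d - (x - y)" using x y by auto
    also have "\<dots> = act (?t ^ q - 1) (0\<^sub>v d - z)"
      unfolding xy by (simp only: act_diff_vec[OF zero_carrier_vec z(1)] act_zero_vec)
    finally have "y - x = act (?t ^ q - 1) (0\<^sub>v d - z)" .
    then show ?thesis using that[of "0\<^sub>v d - z"] z y_def by simp
  qed
qed

lemma G_simps [simp]:
  "carrier G = UNIV \<times> V" "(i, x) \<otimes>\<^bsub>G\<^esub> (j, y) = (i + j, x + pw i y)" "\<one>\<^bsub>G\<^esub> = (0, 0\<^sub>v d)"
  by (simp_all add: semidirect_Z_def pw_def)

sublocale G: group G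
  by (rule group_semidirect_Z[OF \<phi>])

lemma pw_zero_vec [simp]: "pw i (0\<^sub>v d) = 0\<^sub>v d"
  using pw_act[of "0\<^sub>v d" i 0] by simp

lemma uminus_eq_act: "x \<in> V \<Longrightarrow> - x = act [:-1:] x"
  by (auto simp: act_const)

lemma pw_uminus: "x \<in> V \<Longrightarrow> pw i (- x) = - pw i x"
  by (simp add: uminus_eq_act pw_act)

lemma G_inv [simp]: "x \<in> V \<Longrightarrow> inv\<^bsub>G\<^esub> (i, x) = (- i, - pw (- i) x)"
  by (rule G.inv_equality) auto

lemma vec_pow: "x \<in> V \<Longrightarrow> (0, x) [^]\<^bsub>G\<^esub> (n::nat) = (0, act [:int n:] x)"
proof (induction n)
  case (Suc n)
  have "[:int (Suc n):] = [:int n:] + 1" by (simp add: one_pCons)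
  then have "act [:int (Suc n):] x = act [:int n:] x + x" using Suc.prems by (simp only: act_add act_1)
  then show ?case using Suc by simp
qed simp

lemma shift_pow: "(i, 0\<^sub>v d) [^]\<^bsub>G\<^esub> (n::nat) = (int n * i, 0\<^sub>v d)"
  by (induction n) (auto simp: algebra_simps)

end

section \<open>Quotients of prime power order\<close>

lemma finite_bounded_vecs:
  assumes "finite S"
  shows "finite {v \<in> carrier_vec d. \<forall>i<d. v $ i \<in> S}"
proof (rule finite_subset)
  show "{v \<in> carrier_vec d. \<forall>i<d. v $ i \<in> S} \<subseteq> vec_of_list ` {xs. set xs \<subseteq> S \<and> length xs = d}"
  proof
    fix v assume v: "v \<in> {v \<in> carrier_vec d. \<forall>i<d. v $ i \<in> S}"
    then have "set (list_of_vec v) \<subseteq> S" by (auto simp: set_list_of_vec vec_set_def)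
    then show "v \<in> vec_of_list ` {xs. set xs \<subseteq> S \<and> length xs = d}"
      using v by (intro image_eqI[of _ _ "list_of_vec v"]) (auto simp: vec_list)
  qed
qed (use finite_lists_length_eq[OF assms] in auto)

context lattice_auto
begin

text \<open>
  The elements of G that are trivial in the semidirect product of Z / p^M and V / (s^n V + p^n V). This
  product exists when \<open>\<phi>\<close>^(p^M) acts trivially on the second factor, which is ensured by the
  congruence for t^(p^M) assumed in the following lemmas.
\<close>

definition congruence_kernel :: "nat \<Rightarrow> nat \<Rightarrow> nat \<Rightarrow> (int \<times> int vec) set" where
  "congruence_kernel p M n =
     {(i, x). int (p ^ M) dvd i \<and> x \<in> filtration (int p) n n}"

lemma filtration_zero: "0\<^sub>v d \<in> filtration p m n"
  using filtrationI[of "0\<^sub>v d" "0\<^sub>v d"] by simp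

lemma filtration_uminus: "x \<in> filtration p m n \<Longrightarrow> - x \<in> filtration p m n"
proof -
  assume x: "x \<in> filtration p m n"
  then have "x \<in> V" using filtration_carrier by blast
  then show ?thesis using filtration_act[OF x, of "[:-1:]"] by (simp add: uminus_eq_act)
qed

lemma filtration_pw:
  assumes "x \<in> filtration p m n"
  shows "pw i x \<in> filtration p m n"
proof -
  obtain a b where ab: "a \<in> V" "b \<in> V" "x = act ([:-1, 1:] ^ m) a + act [:p ^ n:] b"
    using assms by (auto simp: filtration_def)
  then have "pw i x = act ([:-1, 1:] ^ m) (pw i a) + act [:p ^ n:] (pw i b)"
    by (simp add: pw_add_vec pw_act)
  then show ?thesis using filtrationI ab by simp
qed

lemma filtration_pw_minus_id:
  assumes M: "[:0, 1:] ^ (p ^ M) = 1 + [:-1, 1 :: int:] ^ n * r + of_nat p ^ n * q"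
    and i: "int (p ^ M) dvd i" and x: "x \<in> V"
  shows "pw i x - x \<in> filtration (int p) n n"
proof -
  obtain j where j: "i = int (p ^ M) * j" using i by auto
  obtain z where z: "z \<in> V" "pw i x - x = act ([:0, 1:] ^ (p ^ M) - 1) z"
    using pw_minus_id[OF x, of "p ^ M" j] j by metis
  have "[:0, 1:] ^ (p ^ M) - 1 = [:-1, 1:] ^ n * r + [:int p ^ n:] * q"
    using M by (simp add: of_nat_poly poly_const_pow)
  then have "pw i x - x = act ([:-1, 1:] ^ n) (act r z) + act [:int p ^ n:] (act q z)"
    using z by (simp only: act_add act_mult)
  then show ?thesis using filtrationI by simp
qed

text \<open>
  Finiteness holds because every coset has a representative (i, y) with 0 \<open>\<le>\<close> i < p^M and with
  coordinates of y between 0 and p^n. Every g in G has a p^M-th power of the form (p^M i, y), and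
  \<open>\<phi>\<close>^(p^M i) is trivial modulo the sublattice, so that the p^n-th power of this element is
  (p^(M+n) i, p^n y) modulo the sublattice, which lies in the kernel.
\<close>

lemma p_group_congruence_quotient:
  assumes p: "prime (p :: nat)"
    and M: "[:0, 1:] ^ (p ^ M) = 1 + [:-1, 1 :: int:] ^ n * r + of_nat p ^ n * q"
  shows "congruence_kernel p M n \<lhd> G"
    and "p_group p (G Mod congruence_kernel p M n)"
proof -
  let ?N = "congruence_kernel p M n" and ?U = "filtration (int p) n n"
  have U_V: "x \<in> V" if "x \<in> ?U" for x using that filtration_carrier by blast
  note near = filtration_pw_minus_id[OF M]
  have sub: "subgroup ?N G"
  proof (rule G.subgroupI)
    show "?N \<subseteq> carrier G" using U_V by (auto simp: congruence_kernel_def)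
    show "?N \<noteq> {}" using filtration_zero by (auto simp: congruence_kernel_def intro!: exI[of _ 0])
  next
    fix g assume "g \<in> ?N"
    then show "inv\<^bsub>G\<^esub> g \<in> ?N"
      using U_V filtration_pw filtration_uminus by (cases g) (auto simp: congruence_kernel_def)
  next
    fix g h assume "g \<in> ?N" "h \<in> ?N"
    then show "g \<otimes>\<^bsub>G\<^esub> h \<in> ?N"
      using filtration_pw filtration_add by (cases g; cases h) (auto simp: congruence_kernel_def)
  qed
  show normal: "?N \<lhd> G"
    unfolding G.normal_inv_iff
  proof (intro conjI ballI sub)
    fix g h assume "g \<in> carrier G" "h \<in> ?N"
    then obtain j y i x where gh: "g = (j, y)" "h = (i, x)" and y: "y \<in> V"
      and x: "x \<in> ?U" and i: "int (p ^ M) dvd i"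
      by (cases g; cases h) (auto simp: congruence_kernel_def)
    have xV: "x \<in> V" by (rule U_V[OF x])
    have "g \<otimes>\<^bsub>G\<^esub> h \<otimes>\<^bsub>G\<^esub> inv\<^bsub>G\<^esub> g = (i, (y + pw j x) + pw (j + i) (- pw (- j) y))"
      using xV y by (simp add: gh)
    also have "pw (j + i) (- pw (- j) y) = - pw i y"
      using y by (simp add: pw_uminus flip: pw_pw)
    also have "(y + pw j x) + - pw i y = pw j x + - (pw i y - y)"
      using pw_closed[OF xV, of j] pw_closed[OF y, of i] y by (auto intro!: eq_vecI)
    finally show "g \<otimes>\<^bsub>G\<^esub> h \<otimes>\<^bsub>G\<^esub> inv\<^bsub>G\<^esub> g \<in> ?N"
      using near[OF i y] filtration_add filtration_uminus filtration_pw[OF x] i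
      by (simp add: congruence_kernel_def)
  qed
  interpret N: normal ?N G by (rule normal)
  (* Bounded representatives, for finiteness of the quotient. *)
  have rep: "\<exists>g\<in>{0..<int (p ^ M)} \<times> {v \<in> V. \<forall>i<d. v $ i \<in> {0..<int p ^ n}}. ?N #>\<^bsub>G\<^esub> (i, x) = ?N #>\<^bsub>G\<^esub> g"
    if x: "x \<in> V" for i x
  proof -
    have pos: "int p > 0" using p prime_gt_0_nat by simp
    define y where "y = vec d (\<lambda>k. x $ k mod int p ^ n)"
    define z where "z = vec d (\<lambda>k. x $ k div int p ^ n)"
    have yz: "y \<in> V" "z \<in> V" by (simp_all add: y_def z_def)
    have x_eq: "x = y + act [:int p ^ n:] z"
      using x by (auto simp: y_def z_def act_const intro!: eq_vecI)
    define a where "a = int (p ^ M) * (i div int (p ^ M))"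
    have aV: "pw a y \<in> V" using yz by simp
    have "act [:int p ^ n:] z \<in> ?U"
      using filtrationI[of "0\<^sub>v d" z n "int p" n] yz by simp
    then have "act [:int p ^ n:] z + - (pw a y - y) \<in> ?U"
      by (intro filtration_add filtration_uminus near yz) (auto simp: a_def)
    moreover have "act [:int p ^ n:] z + - (pw a y - y) = x - pw a y"
      unfolding x_eq using yz aV by (auto intro!: eq_vecI)
    ultimately have "(a, x - pw a y) \<in> ?N"
      by (simp add: congruence_kernel_def a_def)
    moreover have "(i, x) = (a, x - pw a y) \<otimes>\<^bsub>G\<^esub> (i mod int (p ^ M), y)"
      using x aV by (auto simp: a_def intro!: eq_vecI)
    ultimately have "?N #>\<^bsub>G\<^esub> (i, x) = ?N #>\<^bsub>G\<^esub> (i mod int (p ^ M), y)"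
      using yz x N.is_subgroup G.coset_mult_assoc[of ?N "(a, x - pw a y)" "(i mod int (p ^ M), y)"]
        G.coset_join2[of "(a, x - pw a y)" ?N] aV N.subset by simp
    moreover have "y $ k \<in> {0..<int p ^ n}" if "k < d" for k
      using that pos by (simp add: y_def)
    moreover have "i mod int (p ^ M) \<in> {0..<int (p ^ M)}" using pos by simp
    ultimately show ?thesis using yz by blast
  qed
  have Mod: "group (G Mod ?N)" by (rule N.factorgroup_is_group)
  have "carrier (G Mod ?N) \<subseteq> (\<lambda>g. ?N #>\<^bsub>G\<^esub> g) `
      ({0..<int (p ^ M)} \<times> {v \<in> V. \<forall>i<d. v $ i \<in> {0..<int p ^ n}})"
  proof
    fix c assume "c \<in> carrier (G Mod ?N)"
    then obtain i x where "x \<in> V" "c = ?N #>\<^bsub>G\<^esub> (i, x)"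
      by (auto simp: FactGroup_def RCOSETS_def)
    then show "c \<in> (\<lambda>g. ?N #>\<^bsub>G\<^esub> g) `
        ({0..<int (p ^ M)} \<times> {v \<in> V. \<forall>i<d. v $ i \<in> {0..<int p ^ n}})"
      using rep[of x i] by (simp only: image_iff)
  qed
  then have fin: "finite (carrier (G Mod ?N))"
    by (rule finite_subset) (intro finite_imageI finite_cartesian_product finite_bounded_vecs, auto)
  have exp: "g [^]\<^bsub>G\<^esub> (p ^ (M + n)) \<in> ?N" if gG: "g \<in> carrier G" for g
  proof -
    obtain i x where g: "g = (i, x)" and x: "x \<in> V" using gG by (cases g) auto
    have "fst (g [^]\<^bsub>G\<^esub> k) = int k * i \<and> snd (g [^]\<^bsub>G\<^esub> k) \<in> V" for k :: nat
    proof (induction k)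
      case (Suc k)
      then show ?case using x
        by (cases "g [^]\<^bsub>G\<^esub> k") (auto simp: g algebra_simps)
    qed auto
    from this[of "p ^ M"] obtain y where
      h: "g [^]\<^bsub>G\<^esub> (p ^ M) = (int (p ^ M) * i, y)" and y: "y \<in> V"
      by (cases "g [^]\<^bsub>G\<^esub> (p ^ M)") auto
    (* Powers of an element acting trivially modulo ?U are computed coordinatewise, up to ?U. *)
    have "\<exists>u\<in>?U. (int (p ^ M) * i, y) [^]\<^bsub>G\<^esub> k = (int k * (int (p ^ M) * i), act [:int k:] y + u)"
      for k :: nat
    proof (induction k)
      case 0
      then show ?case using y filtration_zero by (auto intro!: bexI[of _ "0\<^sub>v d"])
    next
      case (Suc k)
      then obtain u where u: "u \<in> ?U" "(int (p ^ M) * i, y) [^]\<^bsub>G\<^esub> k =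
          (int k * (int (p ^ M) * i), act [:int k:] y + u)" by blast
      let ?w = "pw (int k * (int (p ^ M) * i)) y"
      have "[:int (Suc k):] = [:int k:] + 1" by (simp add: one_pCons)
      then have "act [:int (Suc k):] y = act [:int k:] y + y" using y by (simp only: act_add act_1)
      moreover have "?w \<in> V" using y by simp
      ultimately have "act [:int k:] y + u + ?w = act [:int (Suc k):] y + (u + (?w - y))"
        using y U_V[OF u(1)] by (auto intro!: eq_vecI)
      moreover have "u + (?w - y) \<in> ?U"
        by (intro filtration_add u near y) auto
      ultimately show ?case
        using u y by (intro bexI[of _ "u + (?w - y)"]) (simp_all add: algebra_simps)
    qed
    from this[of "p ^ n"] obtain u where u: "u \<in> ?U"
      "(int (p ^ M) * i, y) [^]\<^bsub>G\<^esub> (p ^ n) =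
        (int (p ^ n) * (int (p ^ M) * i), act [:int (p ^ n):] y + u)" by blast
    have "act [:int (p ^ n):] y \<in> ?U"
      using filtrationI[of "0\<^sub>v d" y n "int p" n] y by simp
    then have "(int (p ^ M) * i, y) [^]\<^bsub>G\<^esub> (p ^ n) \<in> ?N"
      unfolding u using u(1) filtration_add by (simp add: congruence_kernel_def)
    then show ?thesis
      using gG h by (simp add: power_add G.nat_pow_pow[symmetric])
  qed
  show "p_group p (G Mod ?N)"
  proof (rule p_group_of_p_power_exponent[OF Mod fin p, of "M + n"])
    fix c assume "c \<in> carrier (G Mod ?N)"
    then obtain g where g: "g \<in> carrier G" "c = ?N #>\<^bsub>G\<^esub> g"
      by (auto simp: FactGroup_def RCOSETS_def)
    interpret \<pi>: group_hom G "G Mod ?N" "\<lambda>g. ?N #>\<^bsub>G\<^esub> g"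
      by (intro group_hom.intro group_hom_axioms.intro Mod N.r_coset_hom_Mod G.group_axioms)
    have "c [^]\<^bsub>G Mod ?N\<^esub> (p ^ (M + n)) = ?N #>\<^bsub>G\<^esub> (g [^]\<^bsub>G\<^esub> (p ^ (M + n)))"
      using g by (simp add: \<pi>.hom_nat_pow)
    also have "\<dots> = ?N" 
      using exp[OF g(1)] N.subset by (intro G.coset_join2 N.is_subgroup) blast+
    finally show "c [^]\<^bsub>G Mod ?N\<^esub> (p ^ (M + n)) = \<one>\<^bsub>G Mod ?N\<^esub>" by (simp add: FactGroup_def)
  qed
qed

text \<open>
  An element (i, x) with x nonzero survives in the quotient for a suitable n. If x = 0 then i is not 0,
  and n = 0 leaves the quotient Z / p^M, where M is chosen so large that p^M exceeds the absolute value
  of i.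
\<close>

lemma residually_p_of_trivial_intersection:
  assumes p: "prime (p :: nat)"
    and triv: "\<And>v. (\<And>n. v \<in> filtration (int p) n n) \<Longrightarrow> v = 0\<^sub>v d"
  shows "residually_p p G"
  unfolding residually_p_def
proof (intro ballI impI)
  fix g assume g: "g \<in> carrier G" "g \<noteq> \<one>\<^bsub>G\<^esub>"
  have "\<exists>M n r q. [:0, 1:] ^ (p ^ M) = 1 + [:-1, 1 :: int:] ^ n * r + of_nat p ^ n * q \<and>
      g \<notin> congruence_kernel p M n"
  proof (cases "snd g = 0\<^sub>v d")
    case True
    then have "fst g \<noteq> 0" using g by (cases g) auto
    (* The bound M < p^M makes p^M larger than the absolute value of i. *)
    define M where "M = nat \<bar>fst g\<bar>"
    have "int M < int (p ^ M)" using p prime_ge_2_nat[OF p]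
      by (metis less_exp less_le_trans of_nat_less_iff power_mono zero_le)
    then have "\<not> int (p ^ M) dvd fst g"
      using \<open>fst g \<noteq> 0\<close> zdvd_not_zless[of "\<bar>fst g\<bar>" "int (p ^ M)"] by (auto simp: M_def)
    then have "g \<notin> congruence_kernel p M 0" by (auto simp: congruence_kernel_def)
    moreover have "[:0, 1:] ^ (p ^ M) =
        1 + [:-1, 1 :: int:] ^ 0 * ([:0, 1:] ^ (p ^ M) - 1) + of_nat p ^ 0 * 0" by simp
    ultimately show ?thesis by blast
  next
    case False
    then obtain n where n: "snd g \<notin> filtration (int p) n n" using triv by blast
    obtain M r q where "[:0, 1 :: int:] ^ (p ^ M) = 1 + ([:0, 1:] - 1) ^ n * r + of_nat p ^ n * q"
      using power_near_one[OF p] by blast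
    then have "[:0, 1:] ^ (p ^ M) = 1 + [:-1, 1 :: int:] ^ n * r + of_nat p ^ n * q"
      by (simp add: one_pCons)
    moreover have "g \<notin> congruence_kernel p M n" using n by (auto simp: congruence_kernel_def)
    ultimately show ?thesis by blast
  qed
  then obtain M n r q where
    M: "[:0, 1:] ^ (p ^ M) = 1 + [:-1, 1 :: int:] ^ n * r + of_nat p ^ n * q"
    and gN: "g \<notin> congruence_kernel p M n" by blast
  let ?N = "congruence_kernel p M n"
  interpret N: normal ?N G by (rule p_group_congruence_quotient(1)[OF p M])
  have "?N #>\<^bsub>G\<^esub> g \<noteq> ?N"
    using gN g G.coset_join1[of ?N g] N.is_subgroup N.subset by blast
  then show "\<exists>(P :: nat monoid) \<alpha>. p_group p P \<and> \<alpha> \<in> hom G P \<and> \<alpha> g \<noteq> \<one>\<^bsub>P\<^esub>"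
    by (intro p_group_hom_nat[OF p_group_congruence_quotient(2)[OF p M] N.r_coset_hom_Mod g(1)])
       (simp add: FactGroup_def)
qed

end

section \<open>The criterion for a single prime\<close>

context lattice_auto
begin

text \<open>
  In a group of order p^M every p^M-th power is trivial, hence a homomorphism from G to it is trivial on
  p^M V and, by conjugation with (p^M, 0), on (t^(p^M) - 1) V. If f kills v and f(1) is prime to
  p, then \<open>value_at_one_combination\<close> expresses v as a sum of elements of these two submodules.
\<close>

lemma killed_vector_value_at_one:
  assumes p: "prime (p :: nat)" and res: "residually_p p G"
    and v: "v \<in> V" "v \<noteq> 0\<^sub>v d" "act f v = 0\<^sub>v d"
  shows "int p dvd poly f 1"
proof (rule ccontr)
  assume ndvd: "\<not> int p dvd poly f 1"
  obtain P :: "nat monoid" and \<alpha> where P: "p_group p P" and \<alpha>: "\<alpha> \<in> hom G P"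
    and ne: "\<alpha> (0, v) \<noteq> \<one>\<^bsub>P\<^esub>"
    using res v unfolding residually_p_def by (metis G_simps(1,3) UNIV_I mem_Sigma_iff prod.inject)
  interpret \<alpha>: group_hom G P \<alpha>
    using P \<alpha> G.group_axioms by (simp add: p_group_def group_hom_def group_hom_axioms_def)
  obtain M where M: "order P = p ^ M" using P by (auto simp: p_group_def)
  have exp: "y [^]\<^bsub>P\<^esub> (p ^ M) = \<one>\<^bsub>P\<^esub>" if "y \<in> carrier P" for y
    using \<alpha>.H.pow_order_eq_1[OF that] by (simp add: M)
  have a_closed: "\<alpha> (0, x) \<in> carrier P" if "x \<in> V" for x
    using that by (intro \<alpha>.hom_closed) simp
  have a_add: "\<alpha> (0, x + y) = \<alpha> (0, x) \<otimes>\<^bsub>P\<^esub> \<alpha> (0, y)" if "x \<in> V" "y \<in> V" for x y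
    using that \<alpha>.hom_mult[of "(0, x)" "(0, y)"] by simp
  have a_pM: "\<alpha> (0, act [:int p ^ M:] x) = \<one>\<^bsub>P\<^esub>" if "x \<in> V" for x
    using that \<alpha>.hom_nat_pow[of "(0, x)" "p ^ M"] exp[OF a_closed[OF that]] vec_pow[OF that, of "p ^ M"]
    by simp
  (* Conjugation by (p^M, 0), which \<alpha> sends to the unit, acts on V as t^(p^M). *)
  have a_t: "\<alpha> (0, act ([:0, 1:] ^ (p ^ M) - 1) x) = \<one>\<^bsub>P\<^esub>" if x: "x \<in> V" for x
  proof -
    let ?q = "int (p ^ M)" and ?tx = "act ([:0, 1:] ^ (p ^ M)) x"
    have "\<alpha> (?q, 0\<^sub>v d) = \<one>\<^bsub>P\<^esub>"
      using \<alpha>.hom_nat_pow[of "(1, 0\<^sub>v d)" "p ^ M"] exp shift_pow[of 1 "p ^ M"] by simp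
    moreover have "(?q, 0\<^sub>v d) \<otimes>\<^bsub>G\<^esub> (0, x) = (0, ?tx) \<otimes>\<^bsub>G\<^esub> (?q, 0\<^sub>v d)"
      using x by (simp add: pw_nat del: of_nat_power)
    then have "\<alpha> (?q, 0\<^sub>v d) \<otimes>\<^bsub>P\<^esub> \<alpha> (0, x) = \<alpha> (0, ?tx) \<otimes>\<^bsub>P\<^esub> \<alpha> (?q, 0\<^sub>v d)"
      using x by (simp flip: \<alpha>.hom_mult del: G_simps(2) of_nat_power)
    ultimately have "\<alpha> (0, ?tx) = \<alpha> (0, x)" using a_closed[OF x] a_closed[of ?tx] by simp
    moreover have "?tx = act ([:0, 1:] ^ (p ^ M) - 1) x + x"
      using x by (auto simp: act_diff intro!: eq_vecI)
    ultimately have "\<alpha> (0, act ([:0, 1:] ^ (p ^ M) - 1) x) \<otimes>\<^bsub>P\<^esub> \<alpha> (0, x) = \<alpha> (0, x)"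
      using a_add[of "act ([:0, 1:] ^ (p ^ M) - 1) x" x] x by simp
    then show ?thesis using a_closed x by (simp add: \<alpha>.H.r_cancel_one)
  qed
  obtain a b e where comb: "[:poly f 1 ^ (p ^ M * M):] =
      a * f + b * ([:0, 1:] ^ (p ^ M) - 1) + [:int p ^ M:] * e"
    by (rule value_at_one_combination[OF p])
  have "coprime (poly f 1) (int p)"
    using ndvd p by (metis coprime_commute prime_imp_coprime prime_nat_int_transfer)
  then have "coprime (poly f 1 ^ (p ^ M * M)) (int p ^ M)" by simp
  then obtain u w where uw: "u * poly f 1 ^ (p ^ M * M) + w * int p ^ M = 1"
    using bezout_int[of "poly f 1 ^ (p ^ M * M)" "int p ^ M"] by auto
  have "1 = [:u:] * [:poly f 1 ^ (p ^ M * M):] + [:w:] * [:int p ^ M:]"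
    using uw by (simp add: one_pCons mult.commute)
  also have "\<dots> = ([:u:] * a) * f + ([:0, 1:] ^ (p ^ M) - 1) * ([:u:] * b) +
      [:int p ^ M:] * ([:u:] * e + [:w:])"
    unfolding comb by (simp only: algebra_simps)
  finally have one: "1 = ([:u:] * a) * f + ([:0, 1:] ^ (p ^ M) - 1) * ([:u:] * b) +
      [:int p ^ M:] * ([:u:] * e + [:w:])" .
  have "act 1 v = act ([:u:] * a) (act f v) + act ([:0, 1:] ^ (p ^ M) - 1) (act ([:u:] * b) v) +
      act [:int p ^ M:] (act ([:u:] * e + [:w:]) v)"
    by (subst one) (use v(1) in \<open>simp only: act_add act_mult act_closed\<close>)
  then have "v = act ([:0, 1:] ^ (p ^ M) - 1) (act ([:u:] * b) v) +
      act [:int p ^ M:] (act ([:u:] * e + [:w:]) v)"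
    unfolding v(3) using v by (simp only: act_1 act_zero_vec left_zero_vec act_closed)
  then have "\<alpha> (0, v) = \<one>\<^bsub>P\<^esub> \<otimes>\<^bsub>P\<^esub> \<one>\<^bsub>P\<^esub>"
    using a_add a_t a_pM act_closed by metis
  then show False using ne by simp
qed

theorem residually_p_iff:
  assumes p: "prime (p :: nat)"
  shows "residually_p p G \<longleftrightarrow>
    (\<forall>P. Factorial_Ring.irreducible P \<and> P dvd char_poly_auto d \<phi> \<longrightarrow> int p dvd poly P 1)"
proof
  assume "residually_p p G"
  then show "\<forall>P. Factorial_Ring.irreducible P \<and> P dvd char_poly_auto d \<phi> \<longrightarrow> int p dvd poly P 1"
    unfolding char_poly_auto_def
    by (metis irreducible_factor_kills_vector killed_vector_value_at_one p)
next
  assume *: "\<forall>P. Factorial_Ring.irreducible P \<and> P dvd char_poly_auto d \<phi> \<longrightarrow> int p dvd poly P 1"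
  show "residually_p p G"
  proof (rule residually_p_of_trivial_intersection[OF p])
    fix w assume w: "\<And>n. w \<in> filtration (int p) n n"
    show "w = 0\<^sub>v d"
    proof (rule krull_intersection[OF _ _ w])
      show "prime (int p)" using p by simp
      fix f u assume "u \<in> V" "u \<noteq> 0\<^sub>v d" "act f u = 0\<^sub>v d"
      then obtain P where P: "Factorial_Ring.irreducible P" "P dvd char_poly_auto d \<phi>" "P dvd f"
        unfolding char_poly_auto_def by (rule killed_vector_gives_factor)
      then have "int p dvd poly P 1" using * by blast
      moreover have "poly P 1 dvd poly f 1" using P(3) by (auto simp: dvd_def)
      ultimately show "int p dvd poly f 1" by (rule dvd_trans)
    qed
  qed
qed

end

section \<open>All primes and unipotency\<close>

lemma monic_only_root_one:
  fixes f :: "int poly"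
  assumes "lead_coeff f = 1" "\<And>P. Factorial_Ring.irreducible P \<Longrightarrow> P dvd f \<Longrightarrow> poly P 1 = 0"
  shows "f = [:-1, 1:] ^ degree f"
  using assms
proof (induction "degree f" arbitrary: f)
  case 0
  then obtain c where "f = [:c:]" using degree_eq_zeroE by metis
  then show ?case using 0 by (simp add: one_pCons)
next
  case (Suc n)
  have "f \<noteq> 0" "\<not> is_unit f" using Suc.hyps(2) dvd_imp_degree_le[of f 1] by auto
  then obtain P where P: "prime_elem P" "P dvd f" using prime_divisor_exists[of f] by auto
  then have "poly P 1 = 0" using Suc.prems(2) prime_elem_imp_irreducible by blast
  then have "poly f 1 = 0" using P(2) by (auto simp: dvd_def)
  then obtain q where q: "f = [:-1, 1:] * q" using poly_eq_0_iff_dvd[of f 1] by (auto elim: dvdE)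
  have "q \<noteq> 0" using \<open>f \<noteq> 0\<close> q by auto
  then have "degree f = Suc (degree q)" unfolding q by (subst degree_mult_eq) auto
  moreover have "lead_coeff q = 1" using Suc.prems(1) unfolding q lead_coeff_mult by simp
  moreover have "poly P 1 = 0" if "Factorial_Ring.irreducible P" "P dvd q" for P
    using that Suc.prems(2)[of P] q by (simp del: mult_pCons_left)
  ultimately have "q = [:-1, 1:] ^ degree q" using Suc.hyps by simp
  then show ?case using q \<open>degree f = Suc (degree q)\<close> by (metis power_Suc)
qed

context lattice_auto
begin

lemma unipotent_iff_act: "unipotent d \<phi> \<longleftrightarrow> (\<forall>x\<in>V. act ([:-1, 1:] ^ d) x = 0\<^sub>v d)"
proof -
  have "((\<lambda>v. \<phi> v - v) ^^ n) x = act ([:-1, 1:] ^ n) x" if x: "x \<in> V" for n x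
  proof (induction n)
    case (Suc n)
    have "[:-1, 1:] = [:0, 1:] - (1 :: int poly)" by (simp add: one_pCons)
    then have "\<phi> y - y = act [:-1, 1:] y" if "y \<in> V" for y
      using that by (simp only: act_diff \<phi>_eq_act act_1)
    then have "((\<lambda>v. \<phi> v - v) ^^ Suc n) x = act [:-1, 1:] (act ([:-1, 1:] ^ n) x)"
      using Suc by simp
    then show ?case unfolding power_Suc act_mult[OF x] .
  qed (use x in simp)
  then show ?thesis by (simp add: unipotent_def)
qed

lemma unipotent_if_roots_one:
  assumes "\<And>P. Factorial_Ring.irreducible P \<Longrightarrow> P dvd char_poly_auto d \<phi> \<Longrightarrow> poly P 1 = 0"
  shows "unipotent d \<phi>"
proof -
  have "char_poly_auto d \<phi> = [:-1, 1:] ^ d"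
    using monic_only_root_one[of "char_poly_auto d \<phi>"] assms degree_monic_char_poly[OF A]
    by (simp add: char_poly_auto_def)
  then show ?thesis
    unfolding unipotent_iff_act using act_char_poly by (metis char_poly_auto_def)
qed

text \<open>
  If P kills v, then it kills the last nonzero vector u among the s^j v. Since s u = 0, t acts as the
  identity on u, so P acts on it as P(1).
\<close>

lemma roots_one_if_nilpotent_action:
  assumes nil: "\<And>x. x \<in> V \<Longrightarrow> act ([:-1, 1:] ^ n) x = 0\<^sub>v d"
    and P: "Factorial_Ring.irreducible P" "P dvd char_poly_auto d \<phi>"
  shows "poly P 1 = 0"
proof -
  let ?s = "[:-1, 1:] :: int poly"
  obtain v where v: "v \<in> V" "v \<noteq> 0\<^sub>v d" "act P v = 0\<^sub>v d"
    using irreducible_factor_kills_vector P unfolding char_poly_auto_def by metis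
  define k where "k = (LEAST k. act (?s ^ k) v = 0\<^sub>v d)"
  have k: "act (?s ^ k) v = 0\<^sub>v d" unfolding k_def by (rule LeastI[of _ n]) (rule nil[OF v(1)])
  then obtain j where j: "k = Suc j" using v by (cases k) auto
  define u where "u = act (?s ^ j) v"
  have u0: "u \<noteq> 0\<^sub>v d" using not_less_Least[of j "\<lambda>k. act (?s ^ k) v = 0\<^sub>v d"] j
    by (auto simp: u_def k_def)
  have uV: "u \<in> V" by (simp add: u_def)
  have su: "act ?s u = 0\<^sub>v d" using k v unfolding u_def j power_Suc by (simp only: act_mult)
  have "act P u = 0\<^sub>v d" using v act_commute[of v P "?s ^ j"] by (simp add: u_def)
  have "P = ?s * synthetic_div P 1 + [:poly P 1:]" by (rule synthetic_div_correct'[symmetric])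
  then have "act P u = act (synthetic_div P 1 * ?s + [:poly P 1:]) u" by (simp only: mult.commute)
  also have "\<dots> = act (synthetic_div P 1) (act ?s u) + act [:poly P 1:] u"
    using uV by (simp only: act_add act_mult)
  also have "\<dots> = act [:poly P 1:] u" unfolding su by simp
  finally have "act [:poly P 1:] u = 0\<^sub>v d" using \<open>act P u = 0\<^sub>v d\<close> by simp
  then show ?thesis using act_const_eq_0[OF uV] u0 by blast
qed

lemma unipotent_iff_roots_one:
  "unipotent d \<phi> \<longleftrightarrow>
    (\<forall>P. Factorial_Ring.irreducible P \<and> P dvd char_poly_auto d \<phi> \<longrightarrow> poly P 1 = 0)"
  using unipotent_if_roots_one roots_one_if_nilpotent_action[of d] unipotent_iff_act by blast

theorem residually_all_primes_iff_unipotent: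
  "(\<forall>p::nat. prime p \<longrightarrow> residually_p p G) \<longleftrightarrow> unipotent d \<phi>"
proof
  assume *: "\<forall>p::nat. prime p \<longrightarrow> residually_p p G"
  show "unipotent d \<phi>"
  proof (rule unipotent_if_roots_one)
    fix P assume P: "Factorial_Ring.irreducible P" "P dvd char_poly_auto d \<phi>"
    obtain p :: nat where p: "prime p" "p > nat \<bar>poly P 1\<bar>" using bigger_prime by blast
    then have "int p dvd poly P 1" using * residually_p_iff[OF p(1)] P by blast
    then show "poly P 1 = 0" using p(2) dvd_imp_le_int[of "poly P 1" "int p"] by linarith
  qed
next
  assume "unipotent d \<phi>"
  then show "\<forall>p::nat. prime p \<longrightarrow> residually_p p G"
    using unipotent_iff_roots_one residually_p_iff by simp
qed

end

section \<open>Nilpotency\<close>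

context lattice_auto
begin

lemma commutator_vec_shift:
  assumes "x \<in> V" "y \<in> V"
  shows "(0, x) \<otimes>\<^bsub>G\<^esub> (j, y) \<otimes>\<^bsub>G\<^esub> inv\<^bsub>G\<^esub> (0, x) \<otimes>\<^bsub>G\<^esub> inv\<^bsub>G\<^esub> (j, y) = (0, x - pw j x)"
  using assms by (simp add: pw_uminus flip: pw_pw) (auto intro!: eq_vecI)

text \<open>
  The commutator of (0, u) with (j, y) is (0, u - \<open>\<phi>\<close>^j u), and \<open>\<phi>\<close>^j u - u is a multiple of
  s. The first step of the series only removes the Z-factor, whence the shift of the index by one.
\<close>

lemma lower_central_subset:
  "lower_central G (Suc n) \<subseteq> {0::int} \<times> {act ([:-1, 1:] ^ n) x | x. x \<in> V}"
proof (induction n)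
  case 0
  have "subgroup ({0::int} \<times> V) G"
  proof (rule G.subgroupI)
    show "{0::int} \<times> V \<noteq> {}" using zero_carrier_vec by blast
  qed auto
  moreover have "{x \<otimes>\<^bsub>G\<^esub> y \<otimes>\<^bsub>G\<^esub> inv\<^bsub>G\<^esub> x \<otimes>\<^bsub>G\<^esub> inv\<^bsub>G\<^esub> y | x y. x \<in> carrier G \<and> y \<in> carrier G} \<subseteq> {0::int} \<times> V"
    by auto
  ultimately have "lower_central G (Suc 0) \<subseteq> {0::int} \<times> V"
    by (simp only: lower_central.simps G.generate_subgroup_incl)
  moreover have "V \<subseteq> {act ([:-1, 1:] ^ 0) x | x. x \<in> V}" by force
  ultimately show ?case by blast
next
  case (Suc n)
  let ?D = "\<lambda>n. {act ([:-1, 1:] ^ n) x | x. x \<in> V}"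
  have "subgroup ({0::int} \<times> ?D (Suc n)) G"
  proof (rule G.subgroupI)
    show "{0::int} \<times> ?D (Suc n) \<noteq> {}" using zero_carrier_vec by blast
  next
    fix g assume "g \<in> {0::int} \<times> ?D (Suc n)"
    then obtain x where x: "x \<in> V" "g = (0, act ([:-1, 1:] ^ Suc n) x)" by blast
    then have "inv\<^bsub>G\<^esub> g = (0, act ([:-1, 1:] ^ Suc n) (- x))"
      by (simp only: G_inv act_closed minus_zero pw_0 uminus_eq_act act_commute)
    then show "inv\<^bsub>G\<^esub> g \<in> {0::int} \<times> ?D (Suc n)" using x by (auto simp del: power_Suc)
  next
    fix g h assume "g \<in> {0::int} \<times> ?D (Suc n)" "h \<in> {0::int} \<times> ?D (Suc n)"
    then obtain x y where "x \<in> V" "g = (0, act ([:-1, 1:] ^ Suc n) x)"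
      "y \<in> V" "h = (0, act ([:-1, 1:] ^ Suc n) y)" by blast
    then show "g \<otimes>\<^bsub>G\<^esub> h \<in> {0::int} \<times> ?D (Suc n)"
      by (auto simp: act_add_vec[symmetric] simp del: power_Suc)
  qed auto
  moreover have "{x \<otimes>\<^bsub>G\<^esub> y \<otimes>\<^bsub>G\<^esub> inv\<^bsub>G\<^esub> x \<otimes>\<^bsub>G\<^esub> inv\<^bsub>G\<^esub> y | x y.
      x \<in> lower_central G (Suc n) \<and> y \<in> carrier G} \<subseteq> {0::int} \<times> ?D (Suc n)"
  proof
    fix g assume "g \<in> {x \<otimes>\<^bsub>G\<^esub> y \<otimes>\<^bsub>G\<^esub> inv\<^bsub>G\<^esub> x \<otimes>\<^bsub>G\<^esub> inv\<^bsub>G\<^esub> y | x y.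
      x \<in> lower_central G (Suc n) \<and> y \<in> carrier G}"
    then obtain i u j y where iu: "(i, u) \<in> lower_central G (Suc n)" and jy: "(j, y) \<in> carrier G"
      and g: "g = (i, u) \<otimes>\<^bsub>G\<^esub> (j, y) \<otimes>\<^bsub>G\<^esub> inv\<^bsub>G\<^esub> (i, u) \<otimes>\<^bsub>G\<^esub> inv\<^bsub>G\<^esub> (j, y)"
      by (smt (verit) mem_Collect_eq surj_pair)
    then obtain x where x: "x \<in> V" "u = act ([:-1, 1:] ^ n) x" and i: "i = 0" using Suc.IH by blast
    have y: "y \<in> V" using jy by simp
    obtain z where z: "z \<in> V" "pw j x - x = act ([:0, 1:] ^ 1 - 1) z"
      using pw_minus_id[OF x(1), of 1 j] by auto
    have s: "[:0, 1:] ^ 1 - 1 = [:-1, 1 :: int:]" by (simp add: one_pCons)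
    have "u - pw j u = act ([:-1, 1:] ^ n) (x - pw j x)"
      using x by (simp add: pw_act act_diff_vec)
    also have "x - pw j x = - (pw j x - x)" using x pw_closed[OF x(1), of j] by (auto intro!: eq_vecI)
    also have "\<dots> = act [:-1, 1:] (- z)" unfolding z(2) s using z(1)
      by (simp only: uminus_eq_act act_closed act_commute)
    also have "act ([:-1, 1:] ^ n) (act [:-1, 1:] (- z)) = act ([:-1, 1:] ^ Suc n) (- z)"
      unfolding power_Suc2 using z(1) by (simp only: act_mult uminus_carrier_vec)
    finally have comm: "(i, u) \<otimes>\<^bsub>G\<^esub> (j, y) \<otimes>\<^bsub>G\<^esub> inv\<^bsub>G\<^esub> (i, u) \<otimes>\<^bsub>G\<^esub> inv\<^bsub>G\<^esub> (j, y) =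
        (0, act ([:-1, 1:] ^ Suc n) (- z))"
      using commutator_vec_shift[of u y j] x y i by simp
    show "g \<in> {0::int} \<times> ?D (Suc n)"
      unfolding g comm using z(1) by (intro SigmaI CollectI exI[of _ "- z"] conjI) simp_all
  qed
  ultimately show ?case by (simp only: lower_central.simps(2)[of G "Suc n"] G.generate_subgroup_incl)
qed

lemma vec_in_lower_central:
  "x \<in> V \<Longrightarrow> (0, act ([:1, -1:] ^ n) x) \<in> lower_central G n"
proof (induction n)
  case (Suc n)
  let ?u = "act ([:1, -1:] ^ n) x"
  have "[:1, -1:] = 1 - [:0, 1 :: int:]" by (simp add: one_pCons)
  then have "act ([:1, -1:] ^ Suc n) x = ?u - pw 1 ?u"
    unfolding power_Suc using Suc.prems by (simp only: act_mult act_diff act_1 act_closed pw_1 \<phi>_eq_act)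
  then have "(0, act ([:1, -1:] ^ Suc n) x) =
      (0, ?u) \<otimes>\<^bsub>G\<^esub> (1, 0\<^sub>v d) \<otimes>\<^bsub>G\<^esub> inv\<^bsub>G\<^esub> (0, ?u) \<otimes>\<^bsub>G\<^esub> inv\<^bsub>G\<^esub> (1, 0\<^sub>v d)"
    using commutator_vec_shift[of ?u "0\<^sub>v d" 1] by simp
  moreover have "(1, 0\<^sub>v d) \<in> carrier G" by simp
  ultimately show ?case using Suc unfolding lower_central.simps by (intro generate.incl) blast
qed simp

theorem nilpotent_iff_unipotent: "nilpotent_group G \<longleftrightarrow> unipotent d \<phi>"
proof
  assume "nilpotent_group G"
  then obtain n where n: "lower_central G n = {(0, 0\<^sub>v d)}" by (auto simp: nilpotent_group_def)
  show "unipotent d \<phi>"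
  proof (rule unipotent_if_roots_one, rule roots_one_if_nilpotent_action)
    fix x assume x: "x \<in> V"
    have "[:-1, 1:] = [:1, -1:] * [:-1 :: int:]" by simp
    then have "act ([:-1, 1:] ^ n) x = act ([:1, -1:] ^ n) (act ([:-1:] ^ n) x)"
      using x by (simp only: power_mult_distrib act_mult)
    then show "act ([:-1, 1:] ^ n) x = 0\<^sub>v d"
      using vec_in_lower_central[of "act ([:-1:] ^ n) x" n] n by simp
  qed
next
  assume "unipotent d \<phi>"
  then have "{act ([:-1, 1:] ^ d) x | x. x \<in> V} \<subseteq> {0\<^sub>v d}" by (auto simp: unipotent_iff_act)
  then have "lower_central G (Suc d) \<subseteq> {\<one>\<^bsub>G\<^esub>}" 
    using lower_central_subset[of d] unfolding G_simps(3) by blast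
  moreover have "\<one>\<^bsub>G\<^esub> \<in> lower_central G (Suc d)"
    unfolding lower_central.simps by (rule generate.one)
  ultimately show "nilpotent_group G" unfolding nilpotent_group_def by blast
qed

end

section \<open>Subgroups of finite index\<close>

lemma residually_p_injective_hom:
  assumes "f \<in> hom G H" "inj_on f (carrier G)" "group G" "group H" "residually_p p H"
  shows "residually_p p G"
  unfolding residually_p_def
proof (intro ballI impI)
  interpret f: group_hom G H f
    using assms by (simp add: group_hom_def group_hom_axioms_def)
  fix g assume g: "g \<in> carrier G" "g \<noteq> \<one>\<^bsub>G\<^esub>"
  have "f g \<noteq> f \<one>\<^bsub>G\<^esub>" using inj_onD[OF assms(2), of g "\<one>\<^bsub>G\<^esub>"] g by auto
  then have "f g \<noteq> \<one>\<^bsub>H\<^esub>" by simp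
  then obtain P :: "nat monoid" and \<alpha> where "p_group p P" "\<alpha> \<in> hom H P" "\<alpha> (f g) \<noteq> \<one>\<^bsub>P\<^esub>"
    using assms(5) f.hom_closed[OF g(1)] unfolding residually_p_def by blast
  moreover have "\<alpha> \<circ> f \<in> hom G P"
    using assms(1) \<open>\<alpha> \<in> hom H P\<close> by (rule hom_compose)
  ultimately show "\<exists>(P :: nat monoid) \<alpha>. p_group p P \<and> \<alpha> \<in> hom G P \<and> \<alpha> g \<noteq> \<one>\<^bsub>P\<^esub>"
    by (intro exI[of _ P] exI[of _ "\<alpha> \<circ> f"]) simp
qed

lemma (in group) lower_central_subset_carrier: "lower_central G n \<subseteq> carrier G"
proof (induction n)
  case (Suc n)
  then show ?case unfolding lower_central.simps
    by (intro generate_incl) blast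
qed simp

lemma (in group_hom) lower_central_image: "h ` lower_central G n \<subseteq> lower_central H n"
proof (induction n)
  case (Suc n)
  let ?S = "{x \<otimes> y \<otimes> inv x \<otimes> inv y | x y. x \<in> lower_central G n \<and> y \<in> carrier G}"
  have S: "?S \<subseteq> carrier G" using G.lower_central_subset_carrier[of n] by blast
  have "h ` ?S \<subseteq> {x \<otimes>\<^bsub>H\<^esub> y \<otimes>\<^bsub>H\<^esub> inv\<^bsub>H\<^esub> x \<otimes>\<^bsub>H\<^esub> inv\<^bsub>H\<^esub> y | x y.
      x \<in> lower_central H n \<and> y \<in> carrier H}"
  proof
    fix z assume "z \<in> h ` ?S"
    then obtain x y where xy: "x \<in> lower_central G n" "y \<in> carrier G"
      "z = h (x \<otimes> y \<otimes> inv x \<otimes> inv y)" by blast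
    then have "z = h x \<otimes>\<^bsub>H\<^esub> h y \<otimes>\<^bsub>H\<^esub> inv\<^bsub>H\<^esub> h x \<otimes>\<^bsub>H\<^esub> inv\<^bsub>H\<^esub> h y"
      using subsetD[OF G.lower_central_subset_carrier xy(1)] by simp
    moreover have "h x \<in> lower_central H n" using Suc xy by blast
    ultimately show "z \<in> {x \<otimes>\<^bsub>H\<^esub> y \<otimes>\<^bsub>H\<^esub> inv\<^bsub>H\<^esub> x \<otimes>\<^bsub>H\<^esub> inv\<^bsub>H\<^esub> y | x y.
      x \<in> lower_central H n \<and> y \<in> carrier H}" using hom_closed[OF xy(2)] by blast
  qed
  then show ?case
    unfolding lower_central.simps generate_img[OF S, symmetric] by (rule H.mono_generate)
qed auto

lemma nilpotent_injective_hom: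
  assumes "f \<in> hom G H" "inj_on f (carrier G)" "group G" "group H" "nilpotent_group H"
  shows "nilpotent_group G"
proof -
  interpret f: group_hom G H f
    using assms by (simp add: group_hom_def group_hom_axioms_def)
  obtain n where n: "lower_central H n = {\<one>\<^bsub>H\<^esub>}"
    using assms(5) unfolding nilpotent_group_def by blast
  have "x = \<one>\<^bsub>G\<^esub>" if x: "x \<in> lower_central G n" for x
  proof -
    have "f x = f \<one>\<^bsub>G\<^esub>" using f.lower_central_image[of n] x n by auto
    then show ?thesis
      by (rule inj_onD[OF assms(2)]) (use subsetD[OF f.G.lower_central_subset_carrier x] in auto)
  qed
  moreover have "\<one>\<^bsub>G\<^esub> \<in> lower_central G n"
    by (cases n) (auto intro: generate.one)
  ultimately show ?thesis unfolding nilpotent_group_def by blast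
qed

text \<open>
  Two of the N + 1 cosets of 1, g, ..., g^N coincide, so that g^k is in H for some k between 1 and N. The
  exponent N! works for all g at once.
\<close>

lemma (in group) finite_index_power:
  assumes "finite_index_subgroup H G"
  obtains m :: nat where "m > 0" "\<And>g. g \<in> carrier G \<Longrightarrow> g [^] m \<in> H"
proof -
  have H: "subgroup H G" and fin: "finite (rcosets H)"
    using assms by (auto simp: finite_index_subgroup_def)
  define N where "N = card (rcosets H)"
  have "\<exists>k. 0 < k \<and> k \<le> N \<and> g [^] k \<in> H" if g: "g \<in> carrier G" for g
  proof -
    have "(\<lambda>i. H #> g [^] i) ` {..N} \<subseteq> rcosets H"
      using g subgroup.subset[OF H] by (auto intro!: rcosetsI)
    then have "card ((\<lambda>i. H #> g [^] i) ` {..N}) < card {..N}"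
      using card_mono[OF fin] by (simp add: N_def less_Suc_eq_le)
    then have "\<not> inj_on (\<lambda>i. H #> g [^] i) {..N}" by (rule pigeonhole)
    then obtain i j where "i \<le> N" "j \<le> N" "i \<noteq> j" "H #> g [^] i = H #> g [^] j"
      by (auto simp: inj_on_def)
    then obtain i j where ij: "i < j" "j \<le> N" "H #> g [^] i = H #> g [^] j"
      by (metis nat_neq_iff)
    have "g [^] j \<in> H #> g [^] i"
      unfolding ij(3) using H g by (intro rcos_self) auto
    then obtain h where h: "h \<in> H" "g [^] j = h \<otimes> g [^] i" by (auto simp: r_coset_def)
    have "g [^] (j - i) \<otimes> g [^] i = h \<otimes> g [^] i"
      using ij(1) g h by (simp add: nat_pow_mult)
    then have "g [^] (j - i) = h" using g h(1) subgroup.mem_carrier[OF H] by simp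
    then show ?thesis using h(1) ij by (intro exI[of _ "j - i"]) auto
  qed
  then have "g [^] (fact N :: nat) \<in> H" if g: "g \<in> carrier G" for g
  proof -
    obtain k where k: "0 < k" "k \<le> N" "g [^] k \<in> H"
      using \<open>\<And>g. g \<in> carrier G \<Longrightarrow> \<exists>k. 0 < k \<and> k \<le> N \<and> g [^] k \<in> H\<close> g by blast
    then obtain c where "fact N = k * c" using dvd_fact[of k N] by (auto elim: dvdE)
    then have "g [^] (fact N :: nat) = (g [^] k) [^] c" using g by (simp add: nat_pow_pow)
    moreover have "(g [^] k) [^] c \<in> H"
      using k(3) H by (induction c) (auto intro: subgroup.one_closed subgroup.m_closed)
    ultimately show ?thesis by simp
  qed
  then show ?thesis using that[of "fact N"] by simp
qed

context lattice_auto
begin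

lemma nat_pow_auto: "\<phi> [^]\<^bsub>AutoGroup (Zpow d)\<^esub> (k::nat) = pw (int k)"
  by (simp add: pw_def int_pow_int)

lemma power_lattice_auto: "lattice_auto d (pw k)"
  by (unfold_locales) (rule pw_auto)

lemma pw_of_pw: "lattice_auto.pw d (pw k) i = pw (k * i)"
proof -
  interpret k: lattice_auto d "pw k" by (rule power_lattice_auto)
  show ?thesis
    unfolding k.pw_def unfolding pw_def
    using group.int_pow_pow[OF group_AutoGroup, of \<phi> k i] \<phi> by (simp add: carrier_AutoGroup)
qed

text \<open>
  If all m-th powers lie in H, then so do (m i, 0) and (0, m x), and (i, x) is sent to
  (m i, m x) injectively. This map is a homomorphism for the action of \<open>\<phi>\<close>^m.
\<close>

lemma finite_index_contains_power_semidirect: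
  assumes "finite_index_subgroup H G"
  obtains m f where "m > 0" "f \<in> hom (semidirect_Z d (pw (int m))) (G\<lparr>carrier := H\<rparr>)"
    "inj_on f (carrier (semidirect_Z d (pw (int m))))"
proof -
  obtain m :: nat where m: "m > 0" "\<And>g. g \<in> carrier G \<Longrightarrow> g [^]\<^bsub>G\<^esub> m \<in> H"
    using G.finite_index_power[OF assms] by blast
  have H: "subgroup H G" using assms by (simp add: finite_index_subgroup_def)
  interpret m: lattice_auto d "pw (int m)" by (rule power_lattice_auto)
  define f where "f = (\<lambda>(i, x). (int m * i, act [:int m:] x))"
  have shift_nat: "(int m * int n, 0\<^sub>v d) \<in> H" for n
    using m(2)[of "(int n, 0\<^sub>v d)"] shift_pow[of "int n" m] by simp
  have shift: "(int m * i, 0\<^sub>v d) \<in> H" for i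
  proof (cases "i \<ge> 0")
    case True
    then show ?thesis using shift_nat[of "nat i"] by simp
  next
    case False
    then have "inv\<^bsub>G\<^esub> (int m * int (nat (- i)), 0\<^sub>v d) = (int m * i, 0\<^sub>v d)" by simp
    then show ?thesis using subgroup.m_inv_closed[OF H shift_nat[of "nat (- i)"]] by simp
  qed
  have fH: "f (i, x) \<in> H" if x: "x \<in> V" for i x
  proof -
    have "(0, act [:int m:] x) \<in> H" using m(2)[of "(0, x)"] vec_pow[OF x, of m] x by simp
    then have "(0, act [:int m:] x) \<otimes>\<^bsub>G\<^esub> (int m * i, 0\<^sub>v d) \<in> H"
      using subgroup.m_closed[OF H _ shift] by blast
    then show ?thesis by (simp add: f_def)
  qed
  have "f \<in> hom (semidirect_Z d (pw (int m))) (G\<lparr>carrier := H\<rparr>)"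
  proof (rule homI)
    fix g h assume "g \<in> carrier (semidirect_Z d (pw (int m)))" "h \<in> carrier (semidirect_Z d (pw (int m)))"
    then obtain i x j y where "g = (i, x)" "h = (j, y)" "x \<in> V" "y \<in> V" by auto
    then show "f (g \<otimes>\<^bsub>semidirect_Z d (pw (int m))\<^esub> h) = f g \<otimes>\<^bsub>G\<lparr>carrier := H\<rparr>\<^esub> f h"
      by (simp add: f_def pw_of_pw act_add_vec pw_act algebra_simps)
  qed (use fH in auto)
  moreover have "inj_on f (carrier (semidirect_Z d (pw (int m))))"
  proof (rule inj_onI)
    fix g h assume "g \<in> carrier (semidirect_Z d (pw (int m)))" "h \<in> carrier (semidirect_Z d (pw (int m)))"
      and eq: "f g = f h"
    then obtain i x j y where gh: "g = (i, x)" "h = (j, y)" "x \<in> V" "y \<in> V" by auto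
    then have "int m * i = int m * j" "act [:int m:] x = act [:int m:] y" using eq by (auto simp: f_def)
    then show "g = h" using m(1) act_const_inj[OF gh(3,4)] gh(1,2) by auto
  qed
  ultimately show ?thesis using that m(1) by blast
qed

text \<open>
  The subgroup kZ x V has the cosets of (r, 0), 0 \<open>\<le>\<close> r < k, and division of the first coordinate by k
  identifies it with the semidirect product for \<open>\<phi>\<close>^k.
\<close>

lemma power_semidirect_finite_index:
  assumes k: "(k::nat) > 0"
  obtains H f where "finite_index_subgroup H G" "f \<in> hom (G\<lparr>carrier := H\<rparr>) (semidirect_Z d (pw (int k)))"
    "inj_on f H"
proof -
  interpret k: lattice_auto d "pw (int k)" by (rule power_lattice_auto)
  define H where "H = {(i, x). int k dvd i \<and> x \<in> V}"
  have H: "subgroup H G"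
  proof (rule G.subgroupI)
    have "(0, 0\<^sub>v d) \<in> H" by (simp add: H_def)
    then show "H \<noteq> {}" by blast
  qed (auto simp: H_def)
  have "rcosets\<^bsub>G\<^esub> H \<subseteq> (\<lambda>r. H #>\<^bsub>G\<^esub> (r, 0\<^sub>v d)) ` {0..<int k}"
  proof
    fix c assume "c \<in> rcosets\<^bsub>G\<^esub> H"
    then obtain i x where x: "x \<in> V" and c: "c = H #>\<^bsub>G\<^esub> (i, x)" by (auto simp: RCOSETS_def)
    let ?h = "(int k * (i div int k), x)" and ?r = "(i mod int k, 0\<^sub>v d)"
    have "?h \<in> H" using x by (simp add: H_def)
    then have "H #>\<^bsub>G\<^esub> ?h = H" using x H by (intro G.coset_join2) auto
    moreover have "(H #>\<^bsub>G\<^esub> ?h) #>\<^bsub>G\<^esub> ?r = H #>\<^bsub>G\<^esub> (?h \<otimes>\<^bsub>G\<^esub> ?r)"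
      using x subgroup.subset[OF H] by (intro G.coset_mult_assoc) auto
    moreover have "?h \<otimes>\<^bsub>G\<^esub> ?r = (i, x)" using x by simp
    ultimately have "c = H #>\<^bsub>G\<^esub> ?r" using c by simp
    then show "c \<in> (\<lambda>r. H #>\<^bsub>G\<^esub> (r, 0\<^sub>v d)) ` {0..<int k}" using k by simp
  qed
  then have "finite (rcosets\<^bsub>G\<^esub> H)" by (rule finite_subset) simp
  then have fin: "finite_index_subgroup H G" using H by (simp add: finite_index_subgroup_def)
  define f where "f = (\<lambda>(i, x :: int vec). (i div int k, x))"
  have "f \<in> hom (G\<lparr>carrier := H\<rparr>) (semidirect_Z d (pw (int k)))"
    using k by (intro homI) (auto simp: f_def H_def pw_of_pw)
  moreover have "inj_on f H" using k by (auto simp: inj_on_def f_def H_def)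
  ultimately show ?thesis using that fin by blast
qed

lemma quasi_unipotent_iff: "quasi_unipotent d \<phi> \<longleftrightarrow> (\<exists>k::nat. k > 0 \<and> unipotent d (pw (int k)))"
  by (simp add: quasi_unipotent_def nat_pow_auto)

lemma group_finite_index: "finite_index_subgroup H G \<Longrightarrow> group (G\<lparr>carrier := H\<rparr>)"
  by (simp add: finite_index_subgroup_def G.subgroup_imp_group)

theorem virtually_residually_all_primes_iff_quasi_unipotent:
  "(\<exists>H. finite_index_subgroup H G \<and>
      (\<forall>p::nat. prime p \<longrightarrow> residually_p p (G\<lparr>carrier := H\<rparr>))) \<longleftrightarrow> quasi_unipotent d \<phi>"
proof
  assume "\<exists>H. finite_index_subgroup H G \<and>
      (\<forall>p::nat. prime p \<longrightarrow> residually_p p (G\<lparr>carrier := H\<rparr>))"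
  then obtain H where H: "finite_index_subgroup H G"
    and res: "\<And>p::nat. prime p \<Longrightarrow> residually_p p (G\<lparr>carrier := H\<rparr>)" by blast
  obtain m f where m: "m > 0" and f: "f \<in> hom (semidirect_Z d (pw (int m))) (G\<lparr>carrier := H\<rparr>)"
    "inj_on f (carrier (semidirect_Z d (pw (int m))))"
    by (rule finite_index_contains_power_semidirect[OF H])
  interpret m: lattice_auto d "pw (int m)" by (rule power_lattice_auto)
  have "residually_p p (semidirect_Z d (pw (int m)))" if "prime p" for p :: nat
    by (rule residually_p_injective_hom[OF f m.G.group_axioms group_finite_index[OF H] res[OF that]])
  then show "quasi_unipotent d \<phi>"
    using m.residually_all_primes_iff_unipotent m quasi_unipotent_iff by blast
next
  assume "quasi_unipotent d \<phi>"
  then obtain k :: nat where k: "k > 0" "unipotent d (pw (int k))" using quasi_unipotent_iff by blast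
  interpret k: lattice_auto d "pw (int k)" by (rule power_lattice_auto)
  obtain H f where H: "finite_index_subgroup H G"
    and f: "f \<in> hom (G\<lparr>carrier := H\<rparr>) (semidirect_Z d (pw (int k)))" "inj_on f H"
    by (rule power_semidirect_finite_index[OF k(1)])
  have "residually_p p (G\<lparr>carrier := H\<rparr>)" if "prime p" for p :: nat
    using k.residually_all_primes_iff_unipotent k(2) that f(2)
    by (intro residually_p_injective_hom[OF f(1) _ group_finite_index[OF H] k.G.group_axioms]) auto
  then show "\<exists>H. finite_index_subgroup H G \<and>
      (\<forall>p::nat. prime p \<longrightarrow> residually_p p (G\<lparr>carrier := H\<rparr>))" using H by blast
qed

theorem virtually_nilpotent_iff_quasi_unipotent: "virtually_nilpotent G \<longleftrightarrow> quasi_unipotent d \<phi>"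
proof
  assume "virtually_nilpotent G"
  then obtain H where H: "finite_index_subgroup H G" and nil: "nilpotent_group (G\<lparr>carrier := H\<rparr>)"
    by (auto simp: virtually_nilpotent_def)
  obtain m f where m: "m > 0" and f: "f \<in> hom (semidirect_Z d (pw (int m))) (G\<lparr>carrier := H\<rparr>)"
    "inj_on f (carrier (semidirect_Z d (pw (int m))))"
    by (rule finite_index_contains_power_semidirect[OF H])
  interpret m: lattice_auto d "pw (int m)" by (rule power_lattice_auto)
  have "nilpotent_group (semidirect_Z d (pw (int m)))"
    by (rule nilpotent_injective_hom[OF f m.G.group_axioms group_finite_index[OF H] nil])
  then show "quasi_unipotent d \<phi>"
    using m.nilpotent_iff_unipotent m quasi_unipotent_iff by blast
next
  assume "quasi_unipotent d \<phi>"
  then obtain k :: nat where k: "k > 0" "unipotent d (pw (int k))" using quasi_unipotent_iff by blast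
  interpret k: lattice_auto d "pw (int k)" by (rule power_lattice_auto)
  obtain H f where H: "finite_index_subgroup H G"
    and f: "f \<in> hom (G\<lparr>carrier := H\<rparr>) (semidirect_Z d (pw (int k)))" "inj_on f H"
    by (rule power_semidirect_finite_index[OF k(1)])
  have "nilpotent_group (G\<lparr>carrier := H\<rparr>)"
    using k.nilpotent_iff_unipotent k(2) f(2)
    by (intro nilpotent_injective_hom[OF f(1) _ group_finite_index[OF H] k.G.group_axioms]) auto
  then show "virtually_nilpotent G" using H by (auto simp: virtually_nilpotent_def)
qed

end

theorem theorem1p1:
  fixes d :: nat and \<phi> :: "int vec \<Rightarrow> int vec" and G :: "(int \<times> int vec) monoid"
  assumes "\<phi> \<in> auto (Zpow d)"
    and "G = semidirect_Z d \<phi>"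
  shows "(\<forall>p::nat. Factorial_Ring.prime p \<longrightarrow>
            (residually_p p G \<longleftrightarrow>
              (\<forall>P :: int poly. Factorial_Ring.irreducible P \<and> P dvd char_poly_auto d \<phi> \<longrightarrow>
                 [poly P 1 = 0] (mod int p))))
       \<and> (((\<forall>p::nat. Factorial_Ring.prime p \<longrightarrow> residually_p p G) \<longleftrightarrow> nilpotent_group G)
          \<and> (nilpotent_group G \<longleftrightarrow> unipotent d \<phi>))
       \<and> (((\<exists>H. finite_index_subgroup H G \<and>
                (\<forall>p::nat. Factorial_Ring.prime p \<longrightarrow> residually_p p (G\<lparr>carrier := H\<rparr>)))
              \<longleftrightarrow> virtually_nilpotent G)
          \<and> (virtually_nilpotent G \<longleftrightarrow> quasi_unipotent d \<phi>))"
proof -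
  interpret lattice_auto d \<phi> by unfold_locales (rule assms(1))
  show ?thesis
    unfolding assms(2) cong_0_iff virtually_residually_all_primes_iff_quasi_unipotent
      virtually_nilpotent_iff_quasi_unipotent residually_all_primes_iff_unipotent
      nilpotent_iff_unipotent
    using residually_p_iff by blast
qed

end
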